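(* Let $N,T>0$ and let $l:[0,\infty)\to[0,1]$ be continuous, strictly decreasing, with $\int_0^\infty x\,l(x)\,dx<\infty$ and $l(x)>0$ for all $x\ge0$. Let $\Phi_B$ and $\Phi_I$ be point processes on $\mathbb{R}^2$, with no assumption on the dependence between them, such that $\Phi_B\le_{ddcx}\Phi_\lambda$ for some $\lambda>0$ and $\Phi_I\le_{idcx}\Phi_\mu$ for some $\mu>0$. Then there exist $P>0$ (with $l(0)\ge TN/P$) and $\gamma>0$ such that the SINR graph $G(\Phi_B,\Phi_I,\gamma)$ with signal power $P$ percolates, i.e. almost surely contains an infinite connected component.
   Context: A point process is a locally finite random counting measure on $\mathbb{R}^2$, also identified with the random collection of its points; $\Phi(B)$ is the number of points in $B$. $\Phi_\lambda$, $\Phi_\mu$ denote homogeneous Poisson point processes on $\mathbb{R}^2$ of intensities $\lambda$, $\mu$. Orders: $f:\mathbb{R}^n\to\mathbb{R}$ is directionally convex ($dcx$) if for all $x,y,p,q\in\mathbb{R}^n$ with $p\le x\le q$, $p\le y\le q$ (componentwise) and $x+y=p+q$ one has $f(x)+f(y)\le f(p)+f(q)$; it is $idcx$ (respectively $ddcx$) if it is $dcx$ and increasing (respectively decreasing) in the componentwise order. For point processes, $\Phi_1\le_{idcx}\Phi_2$ (respectively $\Phi_1\le_{ddcx}\Phi_2$) means that for all finitely many bounded Borel sets $B_1,\ldots,B_n$ and every $idcx$ (respectively $ddcx$) function $f$, $\mathbf{E}[f(\Phi_1(B_1),\ldots,\Phi_1(B_n))]\le\mathbf{E}[f(\Phi_2(B_1),\ldots,\Phi_2(B_n))]$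 whenever both expectations are finite. SINR graph: $P$ is the signal power, $N$ the environmental noise, $T$ the SINR threshold, $\gamma\ge0$ the interference reduction factor and $l$ the attenuation function. For a point process $\Phi$ the interference at $x\in\mathbb{R}^2$ is $I_\Phi(x)=\sum_{X\in\Phi\setminus\{x\}}l(|X-x|)$, and $$\mathrm{SINR}(x,y,\Phi,\gamma)=\frac{P\,l(|x-y|)}{N+\gamma P\,I_{\Phi\setminus\{x\}}(y)}.$$ For two point processes $\Phi_B$ (back-bone) and $\Phi_I$ (interferers) on $\mathbb{R}^2$, defined on the same probability space with arbitrary dependence, $G(\Phi_B,\Phi_I,\gamma)$ is the graph with vertex set $\Phi_B$ in which two nodes $X,Y\in\Phi_B$ are joined by an edge when $\mathrm{SINR}(Y,X,\Phi_I,\gamma)>T$ and $\mathrm{SINR}(X,Y,\Phi_I,\gamma)>T$.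
   Formalization: The formal theorem also assumes that Φ_I has finite mean number of points in every bounded Borel set; without it the claim fails (e.g. Φ_I mixed Poisson with infinite mean intensity satisfies the idcx order vacuously, yet the graph need not percolate). *)

theory Defs
  imports "HOL-Probability.Probability"
begin

section \<open>Point processes on the plane\<close>

text \<open>Multiple points are allowed: the multiplicity of \<open>x\<close> in \<open>m\<close> is the mass of \<open>{x}\<close>.\<close>

definition bounded_borel :: "(real^2) set \<Rightarrow> bool" where
  "bounded_borel B \<longleftrightarrow> B \<in> sets borel \<and> bounded B"

definition counting_measure :: "(real^2) measure \<Rightarrow> bool" where
  "counting_measure m \<longleftrightarrow>
     sets m = sets borel \<and> (\<forall>B. bounded_borel B \<longrightarrow> (\<exists>k::nat. emeasure m B = of_nat k))"

definition point_process :: "'w measure \<Rightarrow> ('w \<Rightarrow> (real^2) measure) \<Rightarrow> bool" where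
  "point_process M \<Phi> \<longleftrightarrow>
     prob_space M \<and>
     (\<forall>\<omega>\<in>space M. counting_measure (\<Phi> \<omega>)) \<and>
     (\<forall>B. bounded_borel B \<longrightarrow> (\<lambda>\<omega>. emeasure (\<Phi> \<omega>) B) \<in> borel_measurable M)"

definition points :: "(real^2) measure \<Rightarrow> (real^2) set" where
  "points m = {x. emeasure m {x} > 0}"

definition remove_point :: "(real^2) measure \<Rightarrow> real^2 \<Rightarrow> (real^2) measure" where
  "remove_point m x = density m (indicator (- {x}))"

text \<open>The one-dimensional law is written out because \<^const>\<open>poisson_pmf\<close> is only specified for
  positive rates, whereas \<open>B\<close> may be a Lebesgue null set here.\<close>

definition poisson_process :: "'w measure \<Rightarrow> ('w \<Rightarrow> (real^2) measure) \<Rightarrow> real \<Rightarrow> bool" where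
  "poisson_process M \<Phi> r \<longleftrightarrow>
     point_process M \<Phi> \<and>
     (\<forall>B. bounded_borel B \<longrightarrow>
        (\<forall>k::nat. measure M {\<omega>\<in>space M. measure (\<Phi> \<omega>) B = real k} =
           (r * measure lborel B) ^ k / fact k * exp (- (r * measure lborel B)))) \<and>
     (\<forall>(n::nat) B. (\<forall>i<n. bounded_borel (B i)) \<longrightarrow> disjoint_family_on B {..<n} \<longrightarrow>
        prob_space.indep_vars M (\<lambda>_. borel) (\<lambda>i \<omega>. measure (\<Phi> \<omega>) (B i)) {..<n})"


section \<open>Directionally convex orders\<close>

text \<open>\<open>\<real>\<^sup>n\<close> is the set of functions on \<open>{..<n}\<close>, extended by \<^const>\<open>undefined\<close>; on it
  the order of the function type is the componentwise order.\<close>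

abbreviation Rn :: "nat \<Rightarrow> (nat \<Rightarrow> real) set" where
  "Rn n \<equiv> {..<n} \<rightarrow>\<^sub>E UNIV"

definition dcx :: "nat \<Rightarrow> ((nat \<Rightarrow> real) \<Rightarrow> real) \<Rightarrow> bool" where
  "dcx n f \<longleftrightarrow>
     (\<forall>x\<in>Rn n. \<forall>y\<in>Rn n. \<forall>p\<in>Rn n. \<forall>q\<in>Rn n.
        p \<le> x \<and> x \<le> q \<and> p \<le> y \<and> y \<le> q \<and> (\<forall>i<n. x i + y i = p i + q i) \<longrightarrow>
        f x + f y \<le> f p + f q)"

definition idcx :: "nat \<Rightarrow> ((nat \<Rightarrow> real) \<Rightarrow> real) \<Rightarrow> bool" where
  "idcx n f \<longleftrightarrow> dcx n f \<and> mono_on (Rn n) f"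

definition ddcx :: "nat \<Rightarrow> ((nat \<Rightarrow> real) \<Rightarrow> real) \<Rightarrow> bool" where
  "ddcx n f \<longleftrightarrow> dcx n f \<and> antimono_on (Rn n) f"

definition counts :: "nat \<Rightarrow> (nat \<Rightarrow> (real^2) set) \<Rightarrow> (real^2) measure \<Rightarrow> (nat \<Rightarrow> real)" where
  "counts n B m = (\<lambda>i\<in>{..<n}. measure m (B i))"

definition pp_order ::
  "(nat \<Rightarrow> ((nat \<Rightarrow> real) \<Rightarrow> real) \<Rightarrow> bool) \<Rightarrow>
   'v measure \<Rightarrow> ('v \<Rightarrow> (real^2) measure) \<Rightarrow> 'w measure \<Rightarrow> ('w \<Rightarrow> (real^2) measure) \<Rightarrow> bool" where
  "pp_order C M1 \<Phi>1 M2 \<Phi>2 \<longleftrightarrow>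
     (\<forall>(n::nat) B f.
        (\<forall>i<n. bounded_borel (B i)) \<longrightarrow> C n f \<longrightarrow>
        integrable M1 (\<lambda>\<omega>. f (counts n B (\<Phi>1 \<omega>))) \<longrightarrow>
        integrable M2 (\<lambda>\<omega>. f (counts n B (\<Phi>2 \<omega>))) \<longrightarrow>
        (\<integral>\<omega>. f (counts n B (\<Phi>1 \<omega>)) \<partial>M1) \<le> (\<integral>\<omega>. f (counts n B (\<Phi>2 \<omega>)) \<partial>M2))"

abbreviation idcx_le ::
  "'v measure \<Rightarrow> ('v \<Rightarrow> (real^2) measure) \<Rightarrow> 'w measure \<Rightarrow> ('w \<Rightarrow> (real^2) measure) \<Rightarrow> bool" where
  "idcx_le \<equiv> pp_order idcx"

abbreviation ddcx_le ::
  "'v measure \<Rightarrow> ('v \<Rightarrow> (real^2) measure) \<Rightarrow> 'w measure \<Rightarrow> ('w \<Rightarrow> (real^2) measure) \<Rightarrow> bool" where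
  "ddcx_le \<equiv> pp_order ddcx"


section \<open>The SINR graph\<close>

text \<open>The interference may be infinite; in \<^typ>\<open>ennreal\<close> the SINR is then 0 (when
  \<open>\<gamma> * P > 0\<close>). The integral with respect to the counting measure is the sum over its points
  with multiplicity.\<close>

definition interference :: "(real \<Rightarrow> real) \<Rightarrow> (real^2) measure \<Rightarrow> real^2 \<Rightarrow> ennreal" where
  "interference l m x = (\<integral>\<^sup>+ X. ennreal (l (norm (X - x))) \<partial>(remove_point m x))"

definition sinr ::
  "(real \<Rightarrow> real) \<Rightarrow> real \<Rightarrow> real \<Rightarrow> real^2 \<Rightarrow> real^2 \<Rightarrow> (real^2) measure \<Rightarrow> real \<Rightarrow> ennreal" where
  "sinr l P N x y m \<gamma> =
     ennreal (P * l (norm (x - y))) /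
     (ennreal N + ennreal (\<gamma> * P) * interference l (remove_point m x) y)"

text \<open>A graph is given by its vertex set and its symmetric, irreflexive edge relation.\<close>

definition sinr_graph ::
  "(real \<Rightarrow> real) \<Rightarrow> real \<Rightarrow> real \<Rightarrow> real \<Rightarrow> (real^2) measure \<Rightarrow> (real^2) measure \<Rightarrow> real \<Rightarrow>
   (real^2) set \<times> (real^2) rel" where
  "sinr_graph l P N T mB mI \<gamma> =
     (points mB,
      {(X, Y). X \<in> points mB \<and> Y \<in> points mB \<and> X \<noteq> Y \<and>
         sinr l P N Y X mI \<gamma> > ennreal T \<and> sinr l P N X Y mI \<gamma> > ennreal T})"

definition connected_component_of_vertex :: "'a set \<times> 'a rel \<Rightarrow> 'a \<Rightarrow> 'a set" where
  "connected_component_of_vertex G X = {Y \<in> fst G. (X, Y) \<in> (snd G)\<^sup>*}"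

definition percolates :: "'a set \<times> 'a rel \<Rightarrow> bool" where
  "percolates G \<longleftrightarrow> (\<exists>X \<in> fst G. infinite (connected_component_of_vertex G X))"

end

theory Submission
  imports Defs
begin

text \<open>Tile the plane by squares of side \<open>r\<close>. A square is bad if it contains no back-bone point or if
  the interference that can be received in it exceeds a level \<open>c\<close>. Applying the ddcx order to
  \<open>max 0 (1 - x)\<close> bounds void probabilities by Poisson ones, and applying the idcx order to hinges
  of weighted sums of counts gives a Chernoff bound for the interference accumulated over many
  squares. Hence \<open>P(all squares of S are bad) \<le> e ^ card S\<close> for every finite \<open>S\<close>, where \<open>e\<close> is as
  small as we like once \<open>r\<close> and then \<open>c\<close> are large; no assumption on the joint law of the two
  processes is needed, because of two events one can always drop the one that covers fewer squares.

  Such a field percolates by renormalisation, without any planar duality: call a \<open>3 \<times> 3\<close> block bad if at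
  least two of its nine children are bad, and iterate. A good block is connected through its good
  children, and two adjacent good blocks are linked by a row (or column) that avoids the at most two
  bad children. The level-\<open>k\<close> bad probability is doubly exponentially small, so
  almost surely all sufficiently large blocks at the origin are good, and their clusters grow to an
  infinite one. Finally, \<open>P\<close> is chosen so large that points of neighbouring good squares overcome
  the noise, and \<open>\<gamma>\<close> so small that interference at most \<open>c\<close> only doubles the noise.\<close>

section \<open>Renormalisation of site percolation\<close>

text \<open>If \<open>w\<close> indexes a block of side \<open>3 ^ k\<close>, then
  \<open>parent w\<close> indexes the block of side \<open>3 ^ Suc k\<close> containing it. On the
  quadrant \<open>nat \<times> nat\<close> the blocks with index \<open>(0, 0)\<close> are nested
  and exhaust all sites.\<close>

definition parent :: "nat \<times> nat \<Rightarrow> nat \<times> nat" where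
  "parent w = (fst w div 3, snd w div 3)"

text \<open>Requiring two distinct bad children makes one level square the bad probability, up to a
  factor counting the pairs.\<close>

fun bad :: "(nat \<times> nat \<Rightarrow> bool) \<Rightarrow> nat \<Rightarrow> nat \<times> nat \<Rightarrow> bool" where
  "bad b 0 z = b z"
| "bad b (Suc k) z = (\<exists>w w'. parent w = z \<and> parent w' = z \<and> w \<noteq> w' \<and> bad b k w \<and> bad b k w')"

definition site_edges :: "(nat \<times> nat \<Rightarrow> bool) \<Rightarrow> (nat \<times> nat) rel" where
  "site_edges G = {(u, v). G u \<and> G v \<and>
     (fst u = fst v \<and> (snd v = Suc (snd u) \<or> snd u = Suc (snd v)) \<or>
      snd u = snd v \<and> (fst v = Suc (fst u) \<or> fst u = Suc (fst v)))}"

section \<open>Paths inside a block of nine children and across adjacent blocks\<close>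

lemma sym_site_edges: "sym (site_edges G)"
  by (auto simp: site_edges_def sym_def)

lemma site_rtrancl_sym: "(u, v) \<in> (site_edges G)\<^sup>* \<Longrightarrow> (v, u) \<in> (site_edges G)\<^sup>*"
  using sym_site_edges by (metis symD sym_rtrancl)

lemma vertical_path:
  assumes "y \<le> y'" "\<And>t. y \<le> t \<Longrightarrow> t \<le> y' \<Longrightarrow> G (x, t)"
  shows "((x, y), (x, y')) \<in> (site_edges G)\<^sup>*"
  using assms
proof (induction y' rule: dec_induct)
  case (step t)
  have "((x, t), (x, Suc t)) \<in> site_edges G"
    using step by (auto simp: site_edges_def)
  with step show ?case by (meson le_Suc_eq rtrancl.rtrancl_into_rtrancl)
qed auto

lemma horizontal_path:
  assumes "x \<le> x'" "\<And>t. x \<le> t \<Longrightarrow> t \<le> x' \<Longrightarrow> G (t, y)"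
  shows "((x, y), (x', y)) \<in> (site_edges G)\<^sup>*"
  using assms
proof (induction x' rule: dec_induct)
  case (step t)
  have "((t, y), (Suc t, y)) \<in> site_edges G"
    using step by (auto simp: site_edges_def)
  with step show ?case by (meson le_Suc_eq rtrancl.rtrancl_into_rtrancl)
qed auto

lemma full_column:
  assumes "\<And>t. t div 3 = b \<Longrightarrow> G (x, t)" "y div 3 = b" "y' div 3 = b"
  shows "((x, y), (x, y')) \<in> (site_edges G)\<^sup>*"
proof -
  have *: "((x, s), (x, s')) \<in> (site_edges G)\<^sup>*" if "s \<le> s'" "s div 3 = b" "s' div 3 = b" for s s'
    using that by (intro vertical_path assms) (auto simp: div_le_mono antisym)
  show ?thesis
    using *[of y y'] *[of y' y] assms site_rtrancl_sym by (meson nat_le_linear)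
qed

lemma full_row:
  assumes "\<And>t. t div 3 = a \<Longrightarrow> G (t, y)" "x div 3 = a" "x' div 3 = a"
  shows "((x, y), (x', y)) \<in> (site_edges G)\<^sup>*"
proof -
  have *: "((s, y), (s', y)) \<in> (site_edges G)\<^sup>*" if "s \<le> s'" "s div 3 = a" "s' div 3 = a" for s s'
    using that by (intro horizontal_path assms) (auto simp: div_le_mono antisym)
  show ?thesis
    using *[of x x'] *[of x' x] assms site_rtrancl_sym by (meson nat_le_linear)
qed

text \<open>The exception \<open>p\<close> may lie outside the block, so blocks whose children are
  all good are covered. As there is one exception only, every row or column of the block that misses
  its coordinate is entirely good.\<close>

definition at_most_one_bad :: "(nat \<times> nat \<Rightarrow> bool) \<Rightarrow> nat \<times> nat \<Rightarrow> bool" where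
  "at_most_one_bad G z \<longleftrightarrow> (\<exists>p. \<forall>w. parent w = z \<longrightarrow> w \<noteq> p \<longrightarrow> G w)"

text \<open>Column \<open>i\<close> and row \<open>j\<close> miss the exception \<open>p\<close>,
  hence are entirely good and meet at the hub \<open>(i, j)\<close>. A child outside the column of
  \<open>p\<close> follows its own column to row \<open>j\<close>; a child in that column lies in
  another row than \<open>p\<close> and follows it to column \<open>i\<close>.\<close>

lemma connected_in_block:
  assumes "at_most_one_bad G z" "parent u = z" "parent v = z" "G u" "G v"
  shows "(u, v) \<in> (site_edges G)\<^sup>*"
proof -
  obtain p where p: "\<And>w. parent w = z \<Longrightarrow> w \<noteq> p \<Longrightarrow> G w"
    using assms(1) by (auto simp: at_most_one_bad_def)
  obtain a b where z: "z = (a, b)" by (cases z)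
  obtain i where i: "i div 3 = a" "i \<noteq> fst p"
  proof (cases "fst p = 3 * a")
    case True
    then show ?thesis using that[of "3 * a + 1"] by auto
  qed (use that[of "3 * a"] in auto)
  obtain j where j: "j div 3 = b" "j \<noteq> snd p"
  proof (cases "snd p = 3 * b")
    case True
    then show ?thesis using that[of "3 * b + 1"] by auto
  qed (use that[of "3 * b"] in auto)
  have to_hub: "(w, (i, j)) \<in> (site_edges G)\<^sup>*" if w: "parent w = z" "w \<noteq> p" for w
  proof -
    obtain x y where xy: "w = (x, y)" by (cases w)
    have par: "x div 3 = a" "y div 3 = b" using w z by (auto simp: xy parent_def)
    show ?thesis
    proof (cases "x = fst p")
      case False
      have "((x, y), (x, j)) \<in> (site_edges G)\<^sup>*"
        using False par j by (intro full_column[of b]) (auto intro!: p simp: parent_def z)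
      moreover have "((x, j), (i, j)) \<in> (site_edges G)\<^sup>*"
        using par i j by (intro full_row[of a]) (auto intro!: p simp: parent_def z)
      ultimately show ?thesis unfolding xy by (rule rtrancl_trans)
    next
      case True
      then have "y \<noteq> snd p" using w xy by auto
      have "((x, y), (i, y)) \<in> (site_edges G)\<^sup>*"
        using \<open>y \<noteq> snd p\<close> par i by (intro full_row[of a]) (auto intro!: p simp: parent_def z)
      moreover have "((i, y), (i, j)) \<in> (site_edges G)\<^sup>*"
        using par i j by (intro full_column[of b]) (auto intro!: p simp: parent_def z)
      ultimately show ?thesis unfolding xy by (rule rtrancl_trans)
    qed
  qed
  show ?thesis
  proof (cases "u = p \<or> v = p")
    case False
    then show ?thesis
      using to_hub[of u] to_hub[of v] assms site_rtrancl_sym by (meson rtrancl_trans)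
  next
    case True
    \<comment> \<open>Then \<open>p\<close> is good, so that the block has no bad child and any hub will do.\<close>
    then have all: "\<And>w. parent w = z \<Longrightarrow> G w" using p assms by metis
    obtain x y x' y' where uv: "u = (x, y)" "v = (x', y')" by (metis surj_pair)
    have par: "x div 3 = a" "y div 3 = b" "x' div 3 = a" "y' div 3 = b"
      using assms z by (auto simp: uv parent_def)
    have "((x, y), (x, y')) \<in> (site_edges G)\<^sup>*"
      using par by (intro full_column[of b]) (auto intro!: all simp: parent_def z)
    moreover have "((x, y'), (x', y')) \<in> (site_edges G)\<^sup>*"
      using par by (intro full_row[of a]) (auto intro!: all simp: parent_def z)
    ultimately show ?thesis unfolding uv by (rule rtrancl_trans)
  qed
qed

text \<open>Three candidates against two forbidden values: two adjacent blocks have at most one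
  exceptional child each, so a row or column running through both misses both exceptions.\<close>

lemma exists_third:
  fixes p q :: nat
  obtains t where "t div 3 = b" "t \<noteq> p" "t \<noteq> q"
proof -
  have "\<not> {3 * b, 3 * b + 1, 3 * b + 2} \<subseteq> {p, q}"
  proof
    assume "{3 * b, 3 * b + 1, 3 * b + 2} \<subseteq> {p, q}"
    then have "card {3 * b, 3 * b + 1, 3 * b + 2} \<le> card {p, q}" by (intro card_mono) auto
    moreover have "card {p, q} \<le> 2" by (simp add: card_insert_if)
    ultimately show False by simp
  qed
  then obtain t where "t \<in> {3 * b, 3 * b + 1, 3 * b + 2}" "t \<notin> {p, q}" by blast
  then show ?thesis using that[of t] by auto
qed

lemma link_adjacent_blocks:
  assumes "(z, z') \<in> site_edges (at_most_one_bad G)"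
  obtains w w' where "parent w = z" "parent w' = z'" "(w, w') \<in> site_edges G"
proof -
  obtain p where p: "\<And>w. parent w = z \<Longrightarrow> w \<noteq> p \<Longrightarrow> G w"
    using assms by (auto simp: at_most_one_bad_def site_edges_def)
  obtain q where q: "\<And>w. parent w = z' \<Longrightarrow> w \<noteq> q \<Longrightarrow> G w"
    using assms by (auto simp: at_most_one_bad_def site_edges_def)
  obtain a b a' b' where z: "z = (a, b)" "z' = (a', b')" by (metis surj_pair)
  obtain s where s: "s div 3 = a" "s \<noteq> fst p" "s \<noteq> fst q" by (rule exists_third)
  obtain t where t: "t div 3 = b" "t \<noteq> snd p" "t \<noteq> snd q" by (rule exists_third)
  consider "a = a'" "b' = Suc b" | "a = a'" "b = Suc b'" | "b = b'" "a' = Suc a" | "b = b'" "a = Suc a'"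
    using assms by (auto simp: site_edges_def z)
  then show ?thesis
  proof cases
    case 1
    \<comment> \<open>\<open>3 * b + 2\<close> is the last coordinate in the lower block and
      \<open>3 * b + 3\<close> the first in the upper one; the other cases are reflections of this
      one.\<close>
    have par: "parent (s, 3 * b + 2) = z" "parent (s, 3 * b + 3) = z'"
      using s 1 by (auto simp: parent_def z)
    have "G (s, 3 * b + 2)" "G (s, 3 * b + 3)"
      using s par by (auto intro: p q)
    then show ?thesis
      using that[OF par] by (simp add: site_edges_def)
  next
    case 2
    have par: "parent (s, 3 * b' + 3) = z" "parent (s, 3 * b' + 2) = z'"
      using s 2 by (auto simp: parent_def z)
    have "G (s, 3 * b' + 3)" "G (s, 3 * b' + 2)"
      using s par by (auto intro: p q)
    then show ?thesis
      using that[OF par] by (simp add: site_edges_def)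
  next
    case 3
    have par: "parent (3 * a + 2, t) = z" "parent (3 * a + 3, t) = z'"
      using t 3 by (auto simp: parent_def z)
    have "G (3 * a + 2, t)" "G (3 * a + 3, t)"
      using t par by (auto intro: p q)
    then show ?thesis
      using that[OF par] by (simp add: site_edges_def)
  next
    case 4
    have par: "parent (3 * a' + 3, t) = z" "parent (3 * a' + 2, t) = z'"
      using t 4 by (auto simp: parent_def z)
    have "G (3 * a' + 3, t)" "G (3 * a' + 2, t)"
      using t par by (auto intro: p q)
    then show ?thesis
      using that[OF par] by (simp add: site_edges_def)
  qed
qed

text \<open>The end site \<open>v\<close> is left arbitrary in the induction, so that the path can
  first be led to the site \<open>w\<close> from which the next block is entered.\<close>

lemma lift_path:
  assumes "(z, z') \<in> (site_edges (at_most_one_bad G))\<^sup>*" "at_most_one_bad G z"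
    and "parent u = z" "G u" "parent v = z'" "G v"
  shows "(u, v) \<in> (site_edges G)\<^sup>*"
  using assms(1) assms(5,6)
proof (induction z' arbitrary: v rule: rtrancl_induct)
  case base
  then show ?case using assms connected_in_block by blast
next
  case (step y z')
  obtain w w' where w: "parent w = y" "parent w' = z'" "(w, w') \<in> site_edges G"
    using link_adjacent_blocks[OF step(2)] by blast
  have "(u, w) \<in> (site_edges G)\<^sup>*"
    using step.IH[of w] w by (auto simp: site_edges_def)
  moreover have "(w', v) \<in> (site_edges G)\<^sup>*"
    using step w by (intro connected_in_block[of G z']) (auto simp: site_edges_def)
  ultimately show ?case using w(3) by (meson rtrancl.rtrancl_into_rtrancl rtrancl_trans)
qed

text \<open>This equation makes the block lemmas available at every level, with the good blocks of
  level \<open>k\<close> in the role of \<open>G\<close>.\<close>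

lemma not_bad_Suc: "(\<lambda>z. \<not> bad b (Suc k) z) = at_most_one_bad (\<lambda>z. \<not> bad b k z)"
  by (rule ext) (simp add: at_most_one_bad_def, metis)

section \<open>Chains of nested good blocks and the infinite cluster\<close>

definition ancestor :: "nat \<Rightarrow> nat \<times> nat \<Rightarrow> nat \<times> nat" where
  "ancestor k u = (fst u div 3 ^ k, snd u div 3 ^ k)"

lemma ancestor_0 [simp]: "ancestor 0 u = u"
  by (simp add: ancestor_def)

lemma ancestor_Suc: "ancestor (Suc k) u = parent (ancestor k u)"
  by (simp add: ancestor_def parent_def div_mult2_eq power_Suc2 del: power_Suc)

text \<open>Refining a path of good level \<open>k\<close> blocks down to sites requires its two end
  sites to lie in good blocks at every intermediate level; along the interior of the path good
  children are supplied by the linking of adjacent blocks.\<close>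

definition good_chain :: "(nat \<times> nat \<Rightarrow> bool) \<Rightarrow> nat \<Rightarrow> nat \<times> nat \<Rightarrow> bool" where
  "good_chain b k u \<longleftrightarrow> (\<forall>j\<le>k. \<not> bad b j (ancestor j u))"

lemma good_chain_connected:
  assumes "good_chain b k u" "good_chain b k v"
    and "(ancestor k u, ancestor k v) \<in> (site_edges (\<lambda>z. \<not> bad b k z))\<^sup>*"
  shows "(u, v) \<in> (site_edges (\<lambda>z. \<not> b z))\<^sup>*"
  using assms
proof (induction k)
  case (Suc k)
  have "(ancestor k u, ancestor k v) \<in> (site_edges (\<lambda>z. \<not> bad b k z))\<^sup>*"
  proof (rule lift_path)
    show "(ancestor (Suc k) u, ancestor (Suc k) v) \<in> (site_edges (at_most_one_bad (\<lambda>z. \<not> bad b k z)))\<^sup>*"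
      using Suc.prems unfolding not_bad_Suc by blast
    show "at_most_one_bad (\<lambda>z. \<not> bad b k z) (ancestor (Suc k) u)"
      using Suc.prems(1) unfolding good_chain_def by (metis not_bad_Suc order.refl)
  qed (use Suc.prems in \<open>auto simp: good_chain_def ancestor_Suc\<close>)
  with Suc show ?case by (auto simp: good_chain_def)
qed simp

text \<open>In the row \<open>3 * snd z\<close> the coordinate \<open>s\<close> avoids both the
  possible bad child \<open>p\<close> and the prescribed \<open>q\<close>. The freedom in
  \<open>q\<close> serves to step out of the block at the origin.\<close>

lemma exists_good_child:
  assumes "\<not> bad b (Suc k) z"
  obtains w where "parent w = z" "w \<noteq> q" "\<not> bad b k w"
proof -
  obtain p where p: "\<And>w. parent w = z \<Longrightarrow> w \<noteq> p \<Longrightarrow> \<not> bad b k w"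
    using assms not_bad_Suc[of b k] unfolding at_most_one_bad_def by metis
  obtain s where s: "s div 3 = fst z" "s \<noteq> fst p" "s \<noteq> fst q" by (rule exists_third)
  show ?thesis
  proof (rule that)
    show "parent (s, 3 * snd z) = z" "(s, 3 * snd z) \<noteq> q" using s by (auto simp: parent_def)
    show "\<not> bad b k (s, 3 * snd z)" using s by (intro p) (auto simp: parent_def)
  qed
qed

lemma exists_good_chain:
  assumes "\<not> bad b k z"
  shows "\<exists>u. good_chain b k u \<and> ancestor k u = z"
  using assms
proof (induction k arbitrary: z)
  case (Suc k)
  obtain w where w: "parent w = z" "\<not> bad b k w"
    using exists_good_child[OF Suc.prems] by blast
  obtain u where "good_chain b k u" "ancestor k u = w"
    using Suc.IH[OF w(2)] by blast
  with w Suc.prems show ?case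
    by (intro exI[of _ u]) (auto simp: good_chain_def ancestor_Suc le_Suc_eq simp del: bad.simps)
qed (auto simp: good_chain_def)

text \<open>For each \<open>k \<ge> K\<close> a site \<open>f k\<close> is taken inside the level
  \<open>Suc k\<close> block at the origin but outside the level \<open>k\<close> one, so these
  sites are distinct. From level \<open>Suc k\<close> on, \<open>f k\<close> lies in the blocks at
  the origin, which are good; hence all these sites belong to one cluster.\<close>

proposition infinite_good_cluster:
  assumes good: "\<And>k. k \<ge> K \<Longrightarrow> \<not> bad b k (0, 0)"
  obtains u where "\<not> b u" "infinite {v. (u, v) \<in> (site_edges (\<lambda>z. \<not> b z))\<^sup>*}"
proof -
  have "\<exists>u. good_chain b k u \<and> ancestor k u \<noteq> (0, 0) \<and> ancestor (Suc k) u = (0, 0)" if k: "k \<ge> K" for k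
  proof -
    obtain w where w: "parent w = (0, 0)" "w \<noteq> (0, 0)" "\<not> bad b k w"
      using exists_good_child[OF good[of "Suc k"]] k by (metis le_SucI)
    obtain u where "good_chain b k u" "ancestor k u = w"
      using exists_good_chain[OF w(3)] by blast
    with w show ?thesis by (intro exI[of _ u]) (auto simp: ancestor_Suc)
  qed
  then obtain f where f: "\<And>k. k \<ge> K \<Longrightarrow> good_chain b k (f k)"
      "\<And>k. k \<ge> K \<Longrightarrow> ancestor k (f k) \<noteq> (0, 0)" "\<And>k. k \<ge> K \<Longrightarrow> ancestor (Suc k) (f k) = (0, 0)"
    by metis
  have anc: "ancestor j (f k) = (0, 0)" if "k \<ge> K" "Suc k \<le> j" for j k
    using that(2)
  proof (induction j rule: dec_induct)
    case base
    then show ?case using f(3) that(1) by simp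
  next
    case (step n)
    then show ?case by (simp only: ancestor_Suc) (simp add: parent_def)
  qed
  have chain: "good_chain b j (f k)" if "k \<ge> K" "k \<le> j" for j k
    unfolding good_chain_def
  proof (intro allI impI)
    fix i assume "i \<le> j"
    show "\<not> bad b i (ancestor i (f k))"
    proof (cases "i \<le> k")
      case True
      then show ?thesis using f(1)[OF that(1)] by (auto simp: good_chain_def)
    next
      case False
      then show ?thesis using anc[of k i] good[of i] that by simp
    qed
  qed
  have conn: "(f K, f k) \<in> (site_edges (\<lambda>z. \<not> b z))\<^sup>*" if k: "k \<ge> K" for k
  proof (rule good_chain_connected[of b "Suc k"])
    \<comment> \<open>At level \<open>Suc k\<close> both sites lie in the block at the origin, so
      the coarse path is empty and only its refinement remains.\<close>
    have "ancestor (Suc k) (f K) = ancestor (Suc k) (f k)" using anc[of K "Suc k"] anc[of k "Suc k"] k by simp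
    then show "(ancestor (Suc k) (f K), ancestor (Suc k) (f k)) \<in> (site_edges (\<lambda>z. \<not> bad b (Suc k) z))\<^sup>*"
      by simp
  qed (use chain k in auto)
  \<comment> \<open>For \<open>i < j\<close> the level \<open>j\<close> block at the origin contains
    \<open>f i\<close> but not \<open>f j\<close>.\<close>
  have "inj_on f {K..}"
  proof (rule linorder_inj_onI')
    fix i j assume "i \<in> {K..}" "j \<in> {K..}" "i < j"
    then show "f i \<noteq> f j" using anc[of i j] f(2)[of j] by auto
  qed
  then have "infinite (f ` {K..})" using finite_imageD infinite_Ici by blast
  moreover have "f ` {K..} \<subseteq> {v. (f K, v) \<in> (site_edges (\<lambda>z. \<not> b z))\<^sup>*}" using conn by auto
  ultimately have "infinite {v. (f K, v) \<in> (site_edges (\<lambda>z. \<not> b z))\<^sup>*}" using finite_subset by blast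
  moreover have "\<not> b (f K)" using f(1)[of K] by (auto simp: good_chain_def dest: spec[of _ 0])
  ultimately show ?thesis using that by blast
qed

section \<open>Probability that all blocks of a finite set are bad\<close>

definition child_pairs :: "nat \<times> nat \<Rightarrow> ((nat \<times> nat) \<times> (nat \<times> nat)) set" where
  "child_pairs z = {(w, w'). parent w = z \<and> parent w' = z \<and> w \<noteq> w'}"

lemma children_eq:
  "{w. parent w = z} = {3 * fst z..<3 * fst z + 3} \<times> {3 * snd z..<3 * snd z + 3}"
proof -
  have *: "n div 3 = m \<longleftrightarrow> n \<in> {3 * m..<3 * m + 3}" for n m :: nat by auto
  show ?thesis
    unfolding set_eq_iff parent_def prod_eq_iff mem_Times_iff mem_Collect_eq fst_conv snd_conv * by simp
qed

text \<open>\<open>81 = 9 * 9\<close> crudely counts all ordered pairs of the nine children.\<close>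

lemma child_pairs_finite: "finite (child_pairs z)"
  and child_pairs_card: "card (child_pairs z) \<le> 81"
proof -
  have sub: "child_pairs z \<subseteq> {w. parent w = z} \<times> {w. parent w = z}"
    by (auto simp: child_pairs_def)
  have fin: "finite ({w. parent w = z} \<times> {w. parent w = z})"
    and card: "card ({w. parent w = z} \<times> {w. parent w = z}) = 81"
    unfolding children_eq by (auto simp: card_cartesian_product)
  show "finite (child_pairs z)" using sub fin by (rule finite_subset)
  show "card (child_pairs z) \<le> 81" using card_mono[OF fin sub] card by simp
qed

lemma bad_Suc_iff: "bad b (Suc k) z \<longleftrightarrow> (\<exists>p\<in>child_pairs z. bad b k (fst p) \<and> bad b k (snd p))"
  by (auto simp: child_pairs_def)

text \<open>\<open>parent\<close> recovers the block from a child, so pairs chosen in different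
  blocks are disjoint and the exponent doubles exactly.\<close>

lemma card_chosen_children:
  assumes "finite S" "\<And>z. z \<in> S \<Longrightarrow> f z \<in> child_pairs z"
  shows "card (\<Union>z\<in>S. {fst (f z), snd (f z)}) = 2 * card S"
proof -
  have par: "parent (fst (f z)) = z" "parent (snd (f z)) = z" "fst (f z) \<noteq> snd (f z)" if "z \<in> S" for z
    using assms(2)[OF that] unfolding child_pairs_def case_prod_beta by blast+
  have "card (\<Union>z\<in>S. {fst (f z), snd (f z)}) = (\<Sum>z\<in>S. card {fst (f z), snd (f z)})"
  proof (intro card_UN_disjoint ballI impI)
    fix z z' assume zz: "z \<in> S" "z' \<in> S" "z \<noteq> z'"
    have "parent w = z" if "w \<in> {fst (f z), snd (f z)}" "z \<in> S" for w z using that par by blast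
    then show "{fst (f z), snd (f z)} \<inter> {fst (f z'), snd (f z')} = {}"
      using zz by (metis disjoint_iff)
  qed (use assms(1) in simp_all)
  also have "\<dots> = (\<Sum>z\<in>S. 2)"
    using par(3) by (intro sum.cong refl) (simp add: card_insert_if)
  finally show ?thesis by simp
qed

lemma bad_measurable:
  assumes "\<And>z. Measurable.pred M (\<lambda>\<omega>. b \<omega> z)"
  shows "Measurable.pred M (\<lambda>\<omega>. bad (b \<omega>) k z)"
proof (induction k arbitrary: z)
  case (Suc k)
  note [measurable] = Suc
  show ?case unfolding bad.simps by measurable
qed (simp add: assms)

text \<open>The bound for all finite sets takes the place of independence and is preserved by the
  recursion. A union bound over the choice of two bad children in each block of \<open>S\<close> has
  at most \<open>81 ^ card S\<close> terms, each concerning \<open>2 * card S\<close> blocks of the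
  previous level.\<close>

lemma (in prob_space) prob_all_bad_le:
  assumes meas: "\<And>z. Measurable.pred M (\<lambda>\<omega>. b \<omega> z)"
    and "e \<ge> 0"
    and le: "\<And>S. finite S \<Longrightarrow> prob {\<omega> \<in> space M. \<forall>z\<in>S. b \<omega> z} \<le> e ^ card S"
    and "finite S"
  shows "prob {\<omega> \<in> space M. \<forall>z\<in>S. bad (b \<omega>) k z} \<le> ((81 * e) ^ 2 ^ k / 81) ^ card S"
  using \<open>finite S\<close>
proof (induction k arbitrary: S)
  case 0
  then show ?case using le by simp
next
  case (Suc k)
  note [measurable] = bad_measurable[OF meas]
  define d where "d = (81 * e) ^ 2 ^ k / 81"
  have d: "d \<ge> 0" using \<open>e \<ge> 0\<close> by (simp add: d_def)
  \<comment> \<open>A member of \<open>F\<close> selects two children in every block of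
    \<open>S\<close>, and \<open>C f\<close> collects them.\<close>
  define F where "F = Pi\<^sub>E S child_pairs"
  define C where "C f = (\<Union>z\<in>S. {fst (f z), snd (f z)})" for f :: "nat \<times> nat \<Rightarrow> (nat \<times> nat) \<times> nat \<times> nat"
  have finF: "finite F" using Suc.prems by (auto simp: F_def intro!: finite_PiE child_pairs_finite)
  have cardF: "real (card F) \<le> 81 ^ card S"
  proof -
    have "card F = (\<Prod>z\<in>S. card (child_pairs z))" unfolding F_def using Suc.prems by (rule card_PiE)
    also have "\<dots> \<le> (\<Prod>z\<in>S. 81)" by (intro prod_mono) (auto simp: child_pairs_card)
    finally have "card F \<le> 81 ^ card S" by simp
    then show ?thesis by (metis of_nat_le_iff of_nat_numeral of_nat_power)
  qed
  have finC: "finite (C f)" for f using Suc.prems by (simp add: C_def)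
  have meas_all [measurable]: "{\<omega> \<in> space M. \<forall>z\<in>A. bad (b \<omega>) k z} \<in> events" if "finite A" for A
    using that by (intro predE pred_intros_finite) measurable
  have "{\<omega> \<in> space M. \<forall>z\<in>S. bad (b \<omega>) (Suc k) z} \<subseteq> (\<Union>f\<in>F. {\<omega> \<in> space M. \<forall>w\<in>C f. bad (b \<omega>) k w})"
  proof
    fix \<omega> assume "\<omega> \<in> {\<omega> \<in> space M. \<forall>z\<in>S. bad (b \<omega>) (Suc k) z}"
    then have \<omega>: "\<omega> \<in> space M" and "\<forall>z\<in>S. \<exists>p\<in>child_pairs z. bad (b \<omega>) k (fst p) \<and> bad (b \<omega>) k (snd p)"
      unfolding bad_Suc_iff by auto
    then obtain g where g: "\<forall>z\<in>S. g z \<in> child_pairs z \<and> bad (b \<omega>) k (fst (g z)) \<and> bad (b \<omega>) k (snd (g z))"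
      by metis
    then have "restrict g S \<in> F" "\<forall>w\<in>C (restrict g S). bad (b \<omega>) k w"
      by (auto simp: F_def C_def)
    with \<omega> show "\<omega> \<in> (\<Union>f\<in>F. {\<omega> \<in> space M. \<forall>w\<in>C f. bad (b \<omega>) k w})" by blast
  qed
  then have "prob {\<omega> \<in> space M. \<forall>z\<in>S. bad (b \<omega>) (Suc k) z}
      \<le> prob (\<Union>f\<in>F. {\<omega> \<in> space M. \<forall>w\<in>C f. bad (b \<omega>) k w})"
    using finF finC by (intro finite_measure_mono sets.finite_UN meas_all) auto
  also have "\<dots> \<le> (\<Sum>f\<in>F. prob {\<omega> \<in> space M. \<forall>w\<in>C f. bad (b \<omega>) k w})"
    using finF finC by (intro finite_measure_subadditive_finite) (auto intro!: meas_all)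
  also have "\<dots> \<le> (\<Sum>f\<in>F. d ^ (2 * card S))"
  proof (rule sum_mono)
    fix f assume "f \<in> F"
    then have "card (C f) = 2 * card S"
      unfolding C_def using Suc.prems by (intro card_chosen_children) (auto simp: F_def)
    then show "prob {\<omega> \<in> space M. \<forall>w\<in>C f. bad (b \<omega>) k w} \<le> d ^ (2 * card S)"
      using Suc.IH[OF finC, of f] by (simp add: d_def)
  qed
  also have "\<dots> = card F * d ^ (2 * card S)" by simp
  also have "\<dots> \<le> 81 ^ card S * d ^ (2 * card S)"
    using cardF d by (intro mult_right_mono) auto
  also have "\<dots> = (81 * d\<^sup>2) ^ card S"
    by (simp add: power_mult power_mult_distrib)
  \<comment> \<open>The recursion replaces \<open>d\<close> by \<open>81 * d\<^sup>2\<close>, so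
    \<open>81 * d\<close> is squared at each level; this explains the closed form.\<close>
  also have "81 * d\<^sup>2 = (81 * e) ^ 2 ^ Suc k / 81"
    by (simp add: d_def power2_eq_square power_add mult_2 field_simps)
  finally show ?case .
qed

text \<open>Borel-Cantelli along the nested blocks at the origin: their bad probabilities are
  summable, so almost surely they are good from some random level on.\<close>

proposition (in prob_space) AE_infinite_good_cluster:
  assumes meas: "\<And>z. Measurable.pred M (\<lambda>\<omega>. b \<omega> z)"
    and "e \<ge> 0" "e \<le> 1 / 162"
    and le: "\<And>S. finite S \<Longrightarrow> prob {\<omega> \<in> space M. \<forall>z\<in>S. b \<omega> z} \<le> e ^ card S"
  shows "AE \<omega> in M. \<exists>u. \<not> b \<omega> u \<and> infinite {v. (u, v) \<in> (site_edges (\<lambda>z. \<not> b \<omega> z))\<^sup>*}"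
proof -
  note [measurable] = bad_measurable[OF meas]
  define A where "A k = {\<omega> \<in> space M. bad (b \<omega>) k (0, 0)}" for k
  have [measurable]: "A k \<in> sets M" for k by (simp add: A_def)
  have "prob (A k) \<le> (1 / 2) ^ k" for k
  proof -
    have "prob (A k) \<le> (81 * e) ^ 2 ^ k / 81"
      using prob_all_bad_le[OF meas \<open>e \<ge> 0\<close> le, of "{(0, 0)}" k] by (simp add: A_def)
    also have "\<dots> \<le> (81 * e) ^ 2 ^ k"
      using \<open>e \<ge> 0\<close> by (simp add: divide_le_eq)
    \<comment> \<open>Since \<open>162 = 2 * 81\<close>, the threshold on \<open>e\<close> gives
      \<open>81 * e \<le> 1 / 2\<close>.\<close>
    also have "\<dots> \<le> (1 / 2) ^ 2 ^ k"
      using assms(2,3) by (intro power_mono) auto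
    also have "\<dots> \<le> (1 / 2) ^ k"
      by (rule power_decreasing) (auto intro: less_imp_le)
    finally show ?thesis .
  qed
  then have "summable (\<lambda>k. prob (A k))"
    by (intro summable_comparison_test_ev[OF _ summable_geometric[of "1 / 2"]]) auto
  then have "AE \<omega> in M. eventually (\<lambda>k. \<omega> \<in> space M - A k) sequentially"
    by (intro borel_cantelli_AE1) (auto simp: emeasure_eq_measure)
  then show ?thesis
  proof eventually_elim
    case (elim \<omega>)
    then obtain K where "\<And>k. k \<ge> K \<Longrightarrow> \<not> bad (b \<omega>) k (0, 0)"
      unfolding eventually_sequentially A_def by blast
    then obtain u where "\<not> b \<omega> u" "infinite {v. (u, v) \<in> (site_edges (\<lambda>z. \<not> b \<omega> z))\<^sup>*}"
      by (rule infinite_good_cluster)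
    then show ?case by (intro exI conjI)
  qed
qed

section \<open>Comparison of point processes with Poisson processes\<close>

lemma counting_measure_nat:
  assumes "counting_measure m" "bounded_borel B"
  obtains k :: nat where "measure m B = real k" "emeasure m B = of_nat k"
proof -
  obtain k :: nat where k: "emeasure m B = of_nat k"
    using assms unfolding counting_measure_def by blast
  then have "measure m B = real k" by (simp add: measure_def)
  with k that show ?thesis by blast
qed

lemma emeasure_counting_measure:
  assumes "counting_measure m" "bounded_borel B"
  shows "emeasure m B = ennreal (measure m B)"
  using counting_measure_nat[OF assms] by (metis ennreal_of_nat_eq_real_of_nat)

lemma point_process_measure_measurable:
  assumes "point_process M \<Phi>" "bounded_borel B"
  shows "(\<lambda>\<omega>. measure (\<Phi> \<omega>) B) \<in> borel_measurable M"
  unfolding measure_def using assms by (auto simp: point_process_def intro!: borel_measurable_enn2real)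

lemma point_process_nat:
  assumes "point_process M \<Phi>" "bounded_borel B" "\<omega> \<in> space M"
  obtains k :: nat where "measure (\<Phi> \<omega>) B = real k"
  using assms counting_measure_nat unfolding point_process_def by metis

text \<open>Convexity of \<open>max 0\<close>: of two pairs with equal sums, the more spread-out one
  has the larger total. The two orientations serve increasing and decreasing linear forms.\<close>

lemma hinge_dcx:
  fixes lx :: real
  assumes "lx + ly = lp + lq"
    and "lp \<le> lx \<and> lp \<le> ly \<and> lx \<le> lq \<and> ly \<le> lq \<or> lq \<le> lx \<and> lq \<le> ly \<and> lx \<le> lp \<and> ly \<le> lp"
  shows "max 0 (c + lx) + max 0 (c + ly) \<le> max 0 (c + lp) + max 0 (c + lq)"
  using assms by (auto simp: max_def)

text \<open>A nonnegative linear form is additive and increasing, so it carries a configuration as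
  in \<open>dcx\<close> to an ordered one on the real line, where convexity of the hinge
  applies.\<close>

lemma idcx_hinge:
  assumes "\<And>i. i < n \<Longrightarrow> 0 \<le> a i"
  shows "idcx n (\<lambda>x. max 0 (c + (\<Sum>i<n. a i * x i)))"
proof -
  have mono: "(\<Sum>i<n. a i * x i) \<le> (\<Sum>i<n. a i * y i)" if "x \<le> y" for x y :: "nat \<Rightarrow> real"
    using that assms by (intro sum_mono mult_left_mono) (auto simp: le_fun_def)
  have "(\<Sum>i<n. a i * x i) + (\<Sum>i<n. a i * y i) = (\<Sum>i<n. a i * p i) + (\<Sum>i<n. a i * q i)"
    if "\<forall>i<n. x i + y i = p i + q i" for x y p q :: "nat \<Rightarrow> real"
    unfolding sum.distrib[symmetric] distrib_left[symmetric] using that by (intro sum.cong) auto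
  then have "dcx n (\<lambda>x. max 0 (c + (\<Sum>i<n. a i * x i)))"
    unfolding dcx_def by (intro ballI impI hinge_dcx disjI1) (blast intro: mono)+
  moreover have "mono_on (Rn n) (\<lambda>x. max 0 (c + (\<Sum>i<n. a i * x i)))"
    by (intro mono_onI max.mono order.refl add_left_mono mono)
  ultimately show ?thesis by (simp add: idcx_def)
qed

lemma ddcx_hinge:
  assumes "0 < n"
  shows "ddcx n (\<lambda>x. max 0 (c - x 0))"
proof -
  have "max 0 (c + - x 0) + max 0 (c + - y 0) \<le> max 0 (c + - p 0) + max 0 (c + - q 0)"
    if "p \<le> x \<and> x \<le> q \<and> p \<le> y \<and> y \<le> q \<and> (\<forall>i<n. x i + y i = p i + q i)" for x y p q :: "nat \<Rightarrow> real"
  proof (rule hinge_dcx)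
    have "x 0 + y 0 = p 0 + q 0" using that assms by blast
    then show "- x 0 + - y 0 = - p 0 + - q 0" by simp
  qed (use that in \<open>simp add: le_fun_def\<close>)
  moreover have "antimono_on (Rn n) (\<lambda>x. max 0 (c - x 0))"
    unfolding monotone_on_def by (intro ballI impI max.mono order.refl diff_left_mono) (simp add: le_fun_def)
  ultimately show ?thesis by (simp add: ddcx_def dcx_def)
qed

text \<open>On natural numbers \<open>max 0 (1 - k)\<close> is the indicator of
  \<open>k = 0\<close>, so a void probability is the expectation of a ddcx function of one
  count.\<close>

lemma void_probability_le:
  assumes pp: "point_process M \<Phi>" and pois: "poisson_process L \<Phi>\<^sub>L r"
    and order: "ddcx_le M \<Phi> L \<Phi>\<^sub>L" and B: "bounded_borel B"
  shows "measure M {\<omega> \<in> space M. measure (\<Phi> \<omega>) B = 0} \<le> exp (- (r * measure lborel B))"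
proof -
  define f where "f x = max 0 (1 - x 0)" for x :: "nat \<Rightarrow> real"
  have ppL: "point_process L \<Phi>\<^sub>L" using pois by (simp add: poisson_process_def)
  \<comment> \<open>Stated for a generic process, because the order asks for the same expectation
    and its finiteness on both sides.\<close>
  have *: "integrable M' (\<lambda>\<omega>. f (counts 1 (\<lambda>_. B) (\<Psi> \<omega>)))"
    "(\<integral>\<omega>. f (counts 1 (\<lambda>_. B) (\<Psi> \<omega>)) \<partial>M') = measure M' {\<omega> \<in> space M'. measure (\<Psi> \<omega>) B = 0}"
    if pp: "point_process M' \<Psi>" for M' :: "'c measure" and \<Psi>
  proof -
    interpret prob_space M' using pp by (simp add: point_process_def)
    note [measurable] = point_process_measure_measurable[OF pp B]
    let ?A = "{\<omega> \<in> space M'. measure (\<Psi> \<omega>) B = 0}"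
    have [measurable]: "?A \<in> sets M'" by measurable
    have eq: "f (counts 1 (\<lambda>_. B) (\<Psi> \<omega>)) = indicator ?A \<omega>" if \<omega>: "\<omega> \<in> space M'" for \<omega>
    proof -
      obtain k :: nat where "measure (\<Psi> \<omega>) B = real k" using point_process_nat[OF pp B \<omega>] .
      then show ?thesis using \<omega> by (cases k) (auto simp: f_def counts_def indicator_def)
    qed
    have "integrable M' (indicator ?A :: _ \<Rightarrow> real)"
      by (simp add: emeasure_eq_measure)
    then show "integrable M' (\<lambda>\<omega>. f (counts 1 (\<lambda>_. B) (\<Psi> \<omega>)))"
      by (subst Bochner_Integration.integrable_cong[OF refl eq])
    have "(\<integral>\<omega>. f (counts 1 (\<lambda>_. B) (\<Psi> \<omega>)) \<partial>M') = (\<integral>\<omega>. indicator ?A \<omega> \<partial>M')"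
      by (rule Bochner_Integration.integral_cong[OF refl eq])
    then show "(\<integral>\<omega>. f (counts 1 (\<lambda>_. B) (\<Psi> \<omega>)) \<partial>M') = measure M' ?A" by simp
  qed
  have "ddcx 1 f" unfolding f_def by (rule ddcx_hinge) simp
  then have "measure M {\<omega> \<in> space M. measure (\<Phi> \<omega>) B = 0} \<le> measure L {\<omega> \<in> space L. measure (\<Phi>\<^sub>L \<omega>) B = 0}"
    using order[unfolded pp_order_def, rule_format, of 1 "\<lambda>_. B" f] B *[OF pp] *[OF ppL] by simp
  also have "\<dots> = exp (- (r * measure lborel B))"
    using pois B unfolding poisson_process_def by (auto dest!: spec[of _ "0::nat"])
  finally show ?thesis .
qed

section \<open>Exponential moments of Poisson counts and the Chernoff bound\<close>

lemma poisson_laplace: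
  assumes pois: "poisson_process K \<Phi> r" and "r \<ge> 0" and B: "bounded_borel B"
  shows "(\<integral>\<^sup>+\<omega>. ennreal (exp (t * measure (\<Phi> \<omega>) B)) \<partial>K) = ennreal (exp (r * measure lborel B * (exp t - 1)))"
proof -
  have pp: "point_process K \<Phi>" using pois by (simp add: poisson_process_def)
  interpret prob_space K using pp by (simp add: point_process_def)
  note [measurable] = point_process_measure_measurable[OF pp B]
  let ?A = "\<lambda>k. {\<omega> \<in> space K. measure (\<Phi> \<omega>) B = real k}"
  define m where "m = r * measure lborel B"
  have m: "m \<ge> 0" using \<open>r \<ge> 0\<close> by (simp add: m_def)
  \<comment> \<open>Split according to the value of the count; what results is the exponential
    series at \<open>m * exp t\<close>. Working in \<open>ennreal\<close> allows finiteness to be a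
    consequence of the value.\<close>
  have "(\<integral>\<^sup>+\<omega>. ennreal (exp (t * measure (\<Phi> \<omega>) B)) \<partial>K)
      = (\<integral>\<^sup>+\<omega>. (\<Sum>k. ennreal (exp (t * real k)) * indicator (?A k) \<omega>) \<partial>K)"
  proof (rule nn_integral_cong)
    fix \<omega> assume \<omega>: "\<omega> \<in> space K"
    obtain k :: nat where k: "measure (\<Phi> \<omega>) B = real k" using point_process_nat[OF pp B \<omega>] .
    have "(\<Sum>j. ennreal (exp (t * real j)) * indicator (?A j) \<omega>)
        = (\<Sum>j\<in>{k}. ennreal (exp (t * real j)) * indicator (?A j) \<omega>)"
      using k by (intro suminf_finite) auto
    then show "ennreal (exp (t * measure (\<Phi> \<omega>) B)) = (\<Sum>j. ennreal (exp (t * real j)) * indicator (?A j) \<omega>)"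
      using k \<omega> by simp
  qed
  also have "\<dots> = (\<Sum>k. ennreal (exp (t * real k)) * emeasure K (?A k))"
    by (subst nn_integral_suminf) (auto intro!: suminf_cong nn_integral_cmult_indicator)
  also have "\<dots> = (\<Sum>k. ennreal (exp (- m) * ((m * exp t) ^ k /\<^sub>R fact k)))"
  proof (rule suminf_cong)
    fix k
    have "measure K (?A k) = m ^ k / fact k * exp (- m)"
      using pois B unfolding poisson_process_def m_def by blast
    then show "ennreal (exp (t * real k)) * emeasure K (?A k) = ennreal (exp (- m) * ((m * exp t) ^ k /\<^sub>R fact k))"
      using m by (simp add: emeasure_eq_measure ennreal_mult[symmetric] power_mult_distrib
          exp_of_nat_mult[symmetric] field_simps)
  qed
  also have "\<dots> = ennreal (exp (- m) * exp (m * exp t))"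
    using m by (intro suminf_ennreal_eq sums_mult exp_converges) auto
  also have "exp (- m) * exp (m * exp t) = exp (m * (exp t - 1))"
    by (simp add: exp_add[symmetric] algebra_simps)
  finally show ?thesis by (simp add: m_def)
qed

lemma poisson_joint_laplace:
  fixes n :: nat
  assumes pois: "poisson_process K \<Phi> r" and "r \<ge> 0"
    and B: "\<And>i. i < n \<Longrightarrow> bounded_borel (B i)" and disj: "disjoint_family_on B {..<n}"
  shows "(\<integral>\<^sup>+\<omega>. ennreal (exp (\<Sum>i<n. a i * measure (\<Phi> \<omega>) (B i))) \<partial>K)
       = ennreal (exp (\<Sum>i<n. r * measure lborel (B i) * (exp (a i) - 1)))"
proof -
  have pp: "point_process K \<Phi>" using pois by (simp add: poisson_process_def)
  interpret prob_space K using pp by (simp add: point_process_def)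
  have indep: "indep_vars (\<lambda>_. borel) (\<lambda>i \<omega>. measure (\<Phi> \<omega>) (B i)) {..<n}"
    using pois B disj unfolding poisson_process_def by blast
  have "(\<integral>\<^sup>+\<omega>. ennreal (exp (\<Sum>i<n. a i * measure (\<Phi> \<omega>) (B i))) \<partial>K)
      = (\<integral>\<^sup>+\<omega>. (\<Prod>i\<in>{..<n}. ennreal (exp (a i * measure (\<Phi> \<omega>) (B i)))) \<partial>K)"
    by (simp add: exp_sum prod_ennreal)
  also have "\<dots> = (\<Prod>i\<in>{..<n}. \<integral>\<^sup>+\<omega>. ennreal (exp (a i * measure (\<Phi> \<omega>) (B i))) \<partial>K)"
    by (intro indep_vars_nn_integral indep_vars_compose2[OF indep]) auto
  also have "\<dots> = (\<Prod>i\<in>{..<n}. ennreal (exp (r * measure lborel (B i) * (exp (a i) - 1))))"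
    using B by (intro prod.cong refl poisson_laplace[OF pois \<open>r \<ge> 0\<close>]) auto
  also have "\<dots> = ennreal (exp (\<Sum>i<n. r * measure lborel (B i) * (exp (a i) - 1)))"
    by (simp add: exp_sum prod_ennreal)
  finally show ?thesis .
qed

text \<open>The Chernoff bound goes through the hinge
  \<open>1[y \<ge> \<kappa>] \<le> max 0 (1 + y - \<kappa>) \<le> exp (y - \<kappa>)\<close> rather than the exponential, whose
  expectation under the smaller process is not known to be finite.\<close>

lemma idcx_chernoff:
  fixes n :: nat
  assumes pp: "point_process M \<Phi>" and pois: "poisson_process K \<Phi>\<^sub>K r" and "r \<ge> 0"
    and order: "idcx_le M \<Phi> K \<Phi>\<^sub>K"
    and mean: "\<And>B. bounded_borel B \<Longrightarrow> integrable M (\<lambda>\<omega>. measure (\<Phi> \<omega>) B)"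
    and B: "\<And>i. i < n \<Longrightarrow> bounded_borel (B i)" and disj: "disjoint_family_on B {..<n}"
    and a: "\<And>i. i < n \<Longrightarrow> 0 \<le> a i"
  shows "measure M {\<omega> \<in> space M. \<kappa> \<le> (\<Sum>i<n. a i * measure (\<Phi> \<omega>) (B i))}
       \<le> exp ((\<Sum>i<n. r * measure lborel (B i) * (exp (a i) - 1)) - \<kappa>)"
proof -
  \<comment> \<open>The shift by \<open>1 - \<kappa>\<close> makes \<open>f\<close> at least 1 on
    the event in question.\<close>
  define f where "f x = max 0 ((1 - \<kappa>) + (\<Sum>i<n. a i * x i))" for x :: "nat \<Rightarrow> real"
  have ppK: "point_process K \<Phi>\<^sub>K" using pois by (simp add: poisson_process_def)
  interpret M: prob_space M using pp by (simp add: point_process_def)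
  interpret K: prob_space K using ppK by (simp add: point_process_def)
  have meas_M: "(\<lambda>\<omega>. \<Sum>i<n. a i * measure (\<Phi> \<omega>) (B i)) \<in> borel_measurable M"
    using point_process_measure_measurable[OF pp B] by (intro borel_measurable_sum borel_measurable_times) auto
  have meas_K: "(\<lambda>\<omega>. \<Sum>i<n. a i * measure (\<Phi>\<^sub>K \<omega>) (B i)) \<in> borel_measurable K"
    using point_process_measure_measurable[OF ppK B] by (intro borel_measurable_sum borel_measurable_times) auto
  note [measurable] = meas_M meas_K
  let ?X = "\<lambda>\<omega>. \<Sum>i<n. a i * measure (\<Phi> \<omega>) (B i)"
  let ?Y = "\<lambda>\<omega>. \<Sum>i<n. a i * measure (\<Phi>\<^sub>K \<omega>) (B i)"
  have fM: "f (counts n B (\<Phi> \<omega>)) = max 0 (1 - \<kappa> + ?X \<omega>)" for \<omega> by (simp add: f_def counts_def)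
  have fK: "f (counts n B (\<Phi>\<^sub>K \<omega>)) = max 0 (1 - \<kappa> + ?Y \<omega>)" for \<omega> by (simp add: f_def counts_def)
  \<comment> \<open>The hinge grows at most linearly in the counts, so finite mean counts suffice
    under \<open>M\<close>.\<close>
  have intM: "integrable M (\<lambda>\<omega>. f (counts n B (\<Phi> \<omega>)))"
    unfolding fM using mean B
    by (intro integrable_max Bochner_Integration.integrable_add Bochner_Integration.integrable_sum integrable_mult_right) auto
  define E where "E = exp ((\<Sum>i<n. r * measure lborel (B i) * (exp (a i) - 1)) - \<kappa>)"
  have nnK: "(\<integral>\<^sup>+\<omega>. ennreal (exp (?Y \<omega> - \<kappa>)) \<partial>K) = ennreal E"
  proof -
    have "(\<integral>\<^sup>+\<omega>. ennreal (exp (?Y \<omega> - \<kappa>)) \<partial>K) = (\<integral>\<^sup>+\<omega>. ennreal (exp (- \<kappa>)) * ennreal (exp (?Y \<omega>)) \<partial>K)"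
      by (simp add: ennreal_mult[symmetric] exp_add[symmetric])
    also have "\<dots> = ennreal (exp (- \<kappa>)) * (\<integral>\<^sup>+\<omega>. ennreal (exp (?Y \<omega>)) \<partial>K)"
      by (rule nn_integral_cmult) measurable
    also have "\<dots> = ennreal E"
      by (subst poisson_joint_laplace[OF pois \<open>r \<ge> 0\<close> B disj])
         (simp_all add: E_def ennreal_mult[symmetric] exp_add[symmetric])
    finally show ?thesis .
  qed
  have intexp: "integrable K (\<lambda>\<omega>. exp (?Y \<omega> - \<kappa>))" "(\<integral>\<omega>. exp (?Y \<omega> - \<kappa>) \<partial>K) = E"
    using nn_integral_eq_integrable[of "\<lambda>\<omega>. exp (?Y \<omega> - \<kappa>)" K E] nnK by (auto simp: E_def)
  have le_exp: "f (counts n B (\<Phi>\<^sub>K \<omega>)) \<le> exp (?Y \<omega> - \<kappa>)" for \<omega>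
    unfolding fK using exp_ge_add_one_self[of "?Y \<omega> - \<kappa>"] by (auto simp: algebra_simps)
  have intK: "integrable K (\<lambda>\<omega>. f (counts n B (\<Phi>\<^sub>K \<omega>)))"
  proof (rule Bochner_Integration.integrable_bound[OF intexp(1)])
    show "(\<lambda>\<omega>. f (counts n B (\<Phi>\<^sub>K \<omega>))) \<in> borel_measurable K" unfolding fK by measurable
    show "AE \<omega> in K. norm (f (counts n B (\<Phi>\<^sub>K \<omega>))) \<le> norm (exp (?Y \<omega> - \<kappa>))"
      using le_exp fK by (intro AE_I2) (simp add: fK)
  qed
  have [measurable]: "{\<omega> \<in> space M. \<kappa> \<le> ?X \<omega>} \<in> sets M" by measurable
  have "measure M {\<omega> \<in> space M. \<kappa> \<le> ?X \<omega>} = (\<integral>\<omega>. indicator {\<omega> \<in> space M. \<kappa> \<le> ?X \<omega>} \<omega> \<partial>M)"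
    by simp
  also have "\<dots> \<le> (\<integral>\<omega>. f (counts n B (\<Phi> \<omega>)) \<partial>M)"
  proof (rule integral_mono[OF _ intM])
    show "integrable M (indicator {\<omega> \<in> space M. \<kappa> \<le> ?X \<omega>} :: _ \<Rightarrow> real)"
      by (simp add: M.emeasure_eq_measure)
  qed (auto simp: fM indicator_def)
  also have "\<dots> \<le> (\<integral>\<omega>. f (counts n B (\<Phi>\<^sub>K \<omega>)) \<partial>K)"
  proof -
    have "idcx n f" unfolding f_def by (rule idcx_hinge) (use a in auto)
    then show ?thesis using order B intM intK unfolding pp_order_def by blast
  qed
  also have "\<dots> \<le> E"
    unfolding intexp(2)[symmetric] by (rule integral_mono[OF intK intexp(1) le_exp])
  finally show ?thesis by (simp add: E_def)
qed

text \<open>If no point of \<open>B\<close> were an atom, the masses of balls shrinking to a point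
  of \<open>B\<close> would tend to 0. Being integers they are eventually 0, and countably many such
  null balls cover \<open>B\<close>, contradicting its positive mass.\<close>

lemma exists_atom:
  assumes m: "counting_measure m" and B: "bounded_borel B" and pos: "measure m B > 0"
  shows "\<exists>x\<in>B. x \<in> points m"
proof (rule ccontr)
  assume neg: "\<not> ?thesis"
  have sets: "sets m = sets borel" using m by (simp add: counting_measure_def)
  have "\<exists>e>0. emeasure m (ball x e) = 0" if "x \<in> B" for x
  proof (rule ccontr)
    assume *: "\<not> ?thesis"
    have bb: "bounded_borel (ball x e)" for e by (simp add: bounded_borel_def)
    have "(\<lambda>n. emeasure m (ball x (1 / Suc n))) \<longlonglongrightarrow> emeasure m (\<Inter>n. ball x (1 / Suc n))"
    proof (rule Lim_emeasure_decseq)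
      show "range (\<lambda>n. ball x (1 / Suc n)) \<subseteq> sets m" by (simp add: sets image_subset_iff)
      show "decseq (\<lambda>n. ball x (1 / Suc n))" by (intro decseq_SucI subset_ball frac_le) simp_all
      show "emeasure m (ball x (1 / Suc n)) \<noteq> \<infinity>" for n
        by (simp add: emeasure_counting_measure[OF m bb])
    qed
    moreover have "(\<Inter>n. ball x (1 / Suc n)) = {x}"
    proof -
      have "y = x" if "\<And>n. y \<in> ball x (1 / Suc n)" for y
      proof (rule ccontr)
        assume "y \<noteq> x"
        then obtain n where "inverse (real (Suc n)) < dist x y" using reals_Archimedean[of "dist x y"] by auto
        then show False using that[of n] by (simp add: inverse_eq_divide)
      qed
      then show ?thesis by (intro subset_antisym subsetI) simp_all
    qed
    moreover have "emeasure m {x} = 0" using neg that by (auto simp: points_def zero_less_iff_neq_zero)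
    ultimately have "(\<lambda>n. emeasure m (ball x (1 / Suc n))) \<longlonglongrightarrow> 0" by simp
    then have "eventually (\<lambda>n. emeasure m (ball x (1 / Suc n)) < 1) sequentially"
      by (rule order_tendstoD) simp
    then obtain n where n: "emeasure m (ball x (1 / Suc n)) < 1" by (auto simp: eventually_sequentially)
    obtain k :: nat where k: "emeasure m (ball x (1 / Suc n)) = of_nat k" using counting_measure_nat[OF m bb] .
    have "k = 0" using n k by (cases k) auto
    with k * show False by (auto dest!: spec[of _ "1 / Suc n"])
  qed
  then obtain e where e: "\<And>x. x \<in> B \<Longrightarrow> e x > 0" "\<And>x. x \<in> B \<Longrightarrow> emeasure m (ball x (e x)) = 0" by metis
  let ?F = "(\<lambda>x. ball x (e x)) ` B"
  \<comment> \<open>Lindelof reduces the cover to a countable one, so that its union is still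
    null.\<close>
  obtain F' where F': "F' \<subseteq> ?F" "countable F'" "\<Union>F' = \<Union>?F"
    using Lindelof[of ?F] by auto
  have "emeasure m (\<Union>S\<in>F'. S) = 0"
  proof -
    have "(\<Union>S\<in>F'. S) \<in> null_sets m"
      using F' e sets by (intro null_sets_UN') (auto simp: null_sets_def)
    then show ?thesis by auto
  qed
  moreover have "B \<subseteq> (\<Union>S\<in>F'. S)" using F'(3) e(1) by force
  moreover have "(\<Union>S\<in>F'. S) \<in> sets m"
    using F' by (auto simp: sets intro!: borel_open open_Union)
  ultimately have "emeasure m B = 0" by (metis emeasure_mono le_zero_eq)
  then show False using pos by (simp add: measure_def)
qed

section \<open>Square cells and their interference\<close>

text \<open>The floors make the squares half-open, so that every point of the plane lies in exactly
  one cell.\<close>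

definition cell :: "real \<Rightarrow> int \<times> int \<Rightarrow> (real^2) set" where
  "cell r z = {x. \<lfloor>x $ 1 / r\<rfloor> = fst z \<and> \<lfloor>x $ 2 / r\<rfloor> = snd z}"

lemma mem_cell_iff:
  assumes "r > 0"
  shows "x \<in> cell r z \<longleftrightarrow> r * of_int (fst z) \<le> x $ 1 \<and> x $ 1 < r * (of_int (fst z) + 1) \<and>
           r * of_int (snd z) \<le> x $ 2 \<and> x $ 2 < r * (of_int (snd z) + 1)"
  using assms by (simp add: cell_def floor_eq_iff pos_le_divide_eq pos_divide_less_eq mult.commute conj_assoc)

lemma cell_disjoint: "z \<noteq> w \<Longrightarrow> cell r z \<inter> cell r w = {}"
  by (auto simp: cell_def prod_eq_iff)

lemma cell_borel [measurable]: "cell r z \<in> sets borel"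
proof -
  have [measurable]: "(\<lambda>x::real^2. x $ i) \<in> borel_measurable borel" for i
    by (intro borel_measurable_continuous_onI continuous_intros)
  have "{x \<in> space borel. \<lfloor>x $ 1 / r\<rfloor> = fst z \<and> \<lfloor>x $ 2 / r\<rfloor> = snd z} \<in> sets (borel :: (real^2) measure)"
    by measurable
  then show ?thesis by (simp add: cell_def)
qed

lemma
  assumes "r > 0"
  shows bounded_borel_cell: "bounded_borel (cell r z)"
    and measure_cell: "measure lborel (cell r z) = r\<^sup>2"
proof -
  define lo :: "real^2" where "lo = (\<chi> i. r * of_int (if i = 1 then fst z else snd z))"
  define hi :: "real^2" where "hi = (\<chi> i. r * (of_int (if i = 1 then fst z else snd z) + 1))"
  \<comment> \<open>The half-open cell is squeezed between an open and a closed box of equal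
    area.\<close>
  have sub: "box lo hi \<subseteq> cell r z" "cell r z \<subseteq> cbox lo hi"
    by (auto simp: mem_cell_iff[OF assms] mem_box_cart forall_2 lo_def hi_def)
  show bb: "bounded_borel (cell r z)"
    using bounded_subset[OF bounded_cbox sub(2)] by (simp add: bounded_borel_def)
  have ne: "cbox lo hi \<noteq> {}"
    using assms by (auto simp: interval_ne_empty_cart lo_def hi_def)
  have "measure lborel (cbox lo hi) = (\<Prod>i\<in>UNIV. hi $ i - lo $ i)"
    by (rule content_cbox_cart[OF ne])
  also have "\<dots> = r\<^sup>2"
    by (simp add: lo_def hi_def algebra_simps power2_eq_square)
  finally have cb: "measure lborel (cbox lo hi) = r\<^sup>2" .
  have b: "measure lborel (box lo hi) = r\<^sup>2"
    using cb by (simp add: measure_lborel_box_eq measure_lborel_cbox_eq)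
  have fin: "cell r z \<in> fmeasurable lborel"
    using fmeasurable_cbox[of lo hi] sub(2) by (rule fmeasurableI2) simp
  have "measure lborel (box lo hi) \<le> measure lborel (cell r z)"
    using sub(1) fin by (intro measure_mono_fmeasurable) auto
  moreover have "measure lborel (cell r z) \<le> measure lborel (cbox lo hi)"
    using sub(2) by (intro measure_mono_fmeasurable) auto
  ultimately show "measure lborel (cell r z) = r\<^sup>2" using b cb by simp
qed

lemma measure_Union_cells:
  fixes r :: real
  assumes "r > 0" "finite S"
  shows "bounded_borel (\<Union>z\<in>S. cell r z)" "measure lborel (\<Union>z\<in>S. cell r z) = card S * r\<^sup>2"
proof -
  show "bounded_borel (\<Union>z\<in>S. cell r z)"
    using assms bounded_borel_cell[OF assms(1)] by (auto simp: bounded_borel_def)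
  have "emeasure lborel (cell r z) < \<infinity>" for z
    using bounded_borel_cell[OF assms(1), of z] by (intro emeasure_bounded_finite) (simp add: bounded_borel_def)
  then have "measure lborel (\<Union>z\<in>S. cell r z) = (\<Sum>z\<in>S. measure lborel (cell r z))"
    using assms(2) cell_disjoint
    by (intro measure_finite_Union) (auto simp: disjoint_family_on_def less_top)
  then show "measure lborel (\<Union>z\<in>S. cell r z) = card S * r\<^sup>2"
    by (simp add: measure_cell[OF assms(1)])
qed

section \<open>Distances between cells and sums over shells\<close>

definition sup_dist :: "int \<times> int \<Rightarrow> int \<times> int \<Rightarrow> nat" where
  "sup_dist z w = nat (max \<bar>fst z - fst w\<bar> \<bar>snd z - snd w\<bar>)"

lemma sup_dist_commute: "sup_dist z w = sup_dist w z"
  by (simp add: sup_dist_def abs_minus_commute)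

lemma real_sup_dist: "real (sup_dist z w) = max \<bar>of_int (fst z) - of_int (fst w)\<bar> \<bar>of_int (snd z) - of_int (snd w)\<bar>"
  by (simp add: sup_dist_def)

text \<open>In the coordinate attaining the sup distance \<open>k\<close>, the cells are separated
  by \<open>k - 1\<close> whole cells. Truncated subtraction gives the trivial bound 0 for equal
  cells.\<close>

lemma cells_apart:
  assumes "r > 0" "x \<in> cell r z" "y \<in> cell r w"
  shows "r * real (sup_dist z w - 1) \<le> norm (x - y)"
proof -
  note c = assms(2,3)[unfolded mem_cell_iff[OF \<open>r > 0\<close>]]
  have 1: "r * (\<bar>of_int (fst z) - of_int (fst w)\<bar> - 1) \<le> \<bar>(x - y) $ 1\<bar>"
    using c by (auto simp: abs_if algebra_simps)
  have 2: "r * (\<bar>of_int (snd z) - of_int (snd w)\<bar> - 1) \<le> \<bar>(x - y) $ 2\<bar>"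
    using c by (auto simp: abs_if algebra_simps)
  have "r * (real (sup_dist z w) - 1) \<le> norm (x - y)"
    using 1 2 component_le_norm_cart[of "x - y" 1] component_le_norm_cart[of "x - y" 2]
    unfolding real_sup_dist by (auto simp: max_def)
  then show ?thesis
    by (cases "sup_dist z w") auto
qed

text \<open>Each coordinate differs by at most \<open>2 * r\<close>, and the Euclidean norm is at
  most the sum of the two coordinate differences.\<close>

lemma cells_near:
  assumes "r > 0" "x \<in> cell r z" "y \<in> cell r w" "\<bar>fst z - fst w\<bar> \<le> 1" "\<bar>snd z - snd w\<bar> \<le> 1"
  shows "norm (x - y) \<le> 4 * r"
proof -
  note c = assms(2,3)[unfolded mem_cell_iff[OF \<open>r > 0\<close>]]
  have *: "\<bar>a - b\<bar> \<le> 2 * r"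
    if "\<bar>i - j\<bar> \<le> 1" "r * of_int i \<le> a" "a < r * (of_int i + 1)" "r * of_int j \<le> b" "b < r * (of_int j + 1)"
    for i j :: int and a b :: real
  proof -
    have "real_of_int i \<le> of_int j + 1" "real_of_int j \<le> of_int i + 1" using that(1) by linarith+
    then have "r * real_of_int i \<le> r * (of_int j + 1)" "r * real_of_int j \<le> r * (of_int i + 1)"
      using \<open>r > 0\<close> by (intro mult_left_mono; simp)+
    with that show ?thesis by (simp add: algebra_simps abs_le_iff)
  qed
  have "norm (x - y) \<le> \<bar>(x - y) $ 1\<bar> + \<bar>(x - y) $ 2\<bar>"
    using norm_le_l1_cart[of "x - y"] by (simp add: sum_2)
  also have "\<dots> \<le> 2 * r + 2 * r"
    using *[OF assms(4), of "x $ 1" "y $ 1"] *[OF assms(5), of "x $ 2" "y $ 2"] c by simp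
  finally show ?thesis by simp
qed

text \<open>The sphere is covered by the four sides of a square, each with \<open>2 * k + 1\<close>
  points. Counting corners twice gives \<open>8 * k + 4\<close>, a bound that includes
  \<open>k = 0\<close>.\<close>

lemma card_sphere_le: "card {w. sup_dist z w = k} \<le> 8 * k + 4" and finite_sphere: "finite {w. sup_dist z w = k}"
proof -
  obtain a b where z: "z = (a, b)" by (cases z)
  let ?K = "int k"
  let ?U = "{a - ?K, a + ?K} \<times> {b - ?K..b + ?K}" and ?V = "{a - ?K..a + ?K} \<times> {b - ?K, b + ?K}"
  have sub: "{w. sup_dist z w = k} \<subseteq> ?U \<union> ?V"
  proof
    fix w assume "w \<in> {w. sup_dist z w = k}"
    moreover obtain c d where w: "w = (c, d)" by (cases w)
    ultimately have "nat (max \<bar>a - c\<bar> \<bar>b - d\<bar>) = k" by (simp add: sup_dist_def z)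
    moreover have "0 \<le> max \<bar>a - c\<bar> \<bar>b - d\<bar>" by simp
    ultimately have "max \<bar>a - c\<bar> \<bar>b - d\<bar> = ?K" by linarith
    then consider "\<bar>a - c\<bar> = ?K" "\<bar>b - d\<bar> \<le> ?K" | "\<bar>b - d\<bar> = ?K" "\<bar>a - c\<bar> \<le> ?K"
      unfolding max_def by (metis nle_le)
    then show "w \<in> ?U \<union> ?V"
    proof cases
      case 1
      then have "c = a - ?K \<or> c = a + ?K" "b - ?K \<le> d" "d \<le> b + ?K" by linarith+
      then show ?thesis by (simp add: w)
    next
      case 2
      then have "d = b - ?K \<or> d = b + ?K" "a - ?K \<le> c" "c \<le> a + ?K" by linarith+
      then show ?thesis by (simp add: w)
    qed
  qed
  have two: "card {c - ?K, c + ?K} \<le> 2" for c by (simp add: card_insert_if)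
  show "finite {w. sup_dist z w = k}" by (rule finite_subset[OF sub]) auto
  have "card {w. sup_dist z w = k} \<le> card (?U \<union> ?V)" by (rule card_mono[OF _ sub]) auto
  also have "\<dots> \<le> card ?U + card ?V" by (rule card_Un_le)
  also have "\<dots> \<le> 2 * (2 * k + 1) + (2 * k + 1) * 2"
    unfolding card_cartesian_product using two by (intro add_mono mult_mono) auto
  finally show "card {w. sup_dist z w = k} \<le> 8 * k + 4" by simp
qed

lemma sum_over_shells_le:
  assumes "finite W" "\<And>k. 0 \<le> g k" and A: "\<And>m. (\<Sum>k<m. (8 * real k + 4) * g k) \<le> A"
  shows "(\<Sum>w\<in>W. g (sup_dist z w)) \<le> A"
proof -
  obtain m where m: "sup_dist z ` W \<subseteq> {..<m}"
    using finite_nat_iff_bounded[of "sup_dist z ` W"] \<open>finite W\<close> by auto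
  have "(\<Sum>w\<in>W. g (sup_dist z w)) = (\<Sum>k<m. \<Sum>w | w \<in> W \<and> sup_dist z w = k. g (sup_dist z w))"
    by (rule sum.group[symmetric]) (use assms m in auto)
  also have "\<dots> \<le> (\<Sum>k<m. (8 * real k + 4) * g k)"
  proof (rule sum_mono)
    fix k
    have "card {w \<in> W. sup_dist z w = k} \<le> card {w. sup_dist z w = k}"
      by (intro card_mono finite_sphere) auto
    then have "card {w \<in> W. sup_dist z w = k} \<le> 8 * k + 4" using card_sphere_le order_trans by blast
    then have "real (card {w \<in> W. sup_dist z w = k}) \<le> 8 * real k + 4"
      by (metis (mono_tags) of_nat_add of_nat_le_iff of_nat_mult of_nat_numeral)
    then show "(\<Sum>w | w \<in> W \<and> sup_dist z w = k. g (sup_dist z w)) \<le> (8 * real k + 4) * g k"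
      using assms(2)[of k] by (simp add: mult_right_mono)
  qed
  also have "\<dots> \<le> A" by (rule A)
  finally show ?thesis .
qed

text \<open>Integral test for \<open>x * l x\<close>: the factor \<open>8 * k + 4\<close> is the
  size of a shell, and \<open>r * (k - 1)\<close> the least distance to it. Past the first three
  shells the size is comparable to the radius.\<close>

lemma shell_sums_bounded:
  fixes l :: "real \<Rightarrow> real"
  assumes "r > 0"
    and l_range: "\<And>x. 0 \<le> x \<Longrightarrow> 0 < l x \<and> l x \<le> 1"
    and l_cont: "continuous_on {0..} l"
    and l_decr: "strict_antimono_on {0..} l"
    and l_int: "set_integrable lborel {0..} (\<lambda>x. x * l x)"
  obtains A where "A > 0" "\<And>m. (\<Sum>k<m. (8 * real k + 4) * l (r * real (k - 1))) \<le> A"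
proof -
  define h where "h x = x * l x" for x
  have h_int: "h integrable_on {0..}"
    using set_borel_integral_eq_integral(1)[OF l_int] by (simp add: h_def[abs_def])
  have h_cont: "continuous_on {a..b} h" if "0 \<le> a" for a b
    unfolding h_def using that by (intro continuous_intros continuous_on_subset[OF l_cont]) auto
  have h_int': "h integrable_on {a..b}" if "0 \<le> a" for a b
    using h_cont[OF that] integrable_continuous_interval by blast
  have anti: "l y \<le> l x" if "0 \<le> x" "x \<le> y" for x y
    using l_decr that by (cases "x = y") (auto simp: monotone_on_def intro: less_imp_le)
  have l0: "0 \<le> l x" if "0 \<le> x" for x using l_range[OF that] by simp
  define I where "I = integral {0..} h"
  \<comment> \<open>On the interval from \<open>r * j\<close> to \<open>r * (j + 1)\<close> the
    integrand is at least \<open>r * j * l (r * (j + 1))\<close>, by monotonicity of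
    \<open>l\<close>; the length supplies the second factor \<open>r\<close>.\<close>
  have step: "(\<Sum>j<m. r\<^sup>2 * (real j * l (r * real (Suc j)))) \<le> integral {0..r * real m} h" for m
  proof (induction m)
    case (Suc m)
    have "r\<^sup>2 * (real m * l (r * real (Suc m))) = integral {r * real m..r * real (Suc m)} (\<lambda>_. r * real m * l (r * real (Suc m)))"
      using \<open>r > 0\<close> by (simp add: power2_eq_square algebra_simps)
    also have "\<dots> \<le> integral {r * real m..r * real (Suc m)} h"
    proof (rule integral_le)
      show "h integrable_on {r * real m..r * real (Suc m)}" using \<open>r > 0\<close> by (intro h_int') simp
      fix x assume x: "x \<in> {r * real m..r * real (Suc m)}"
      have "0 \<le> r * real m" using \<open>r > 0\<close> by simp
      then have "0 \<le> x" using x by simp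
      have "0 \<le> l (r * real (Suc m))" using l_range[of "r * real (Suc m)"] \<open>r > 0\<close> by simp
      then show "r * real m * l (r * real (Suc m)) \<le> h x"
        unfolding h_def using x \<open>0 \<le> x\<close> \<open>0 \<le> r * real m\<close> anti[of x "r * real (Suc m)"]
        by (intro mult_mono) auto
    qed (rule integrable_const_ivl)
    finally have "r\<^sup>2 * (real m * l (r * real (Suc m))) \<le> integral {r * real m..r * real (Suc m)} h" .
    moreover have "integral {0..r * real m} h + integral {r * real m..r * real (Suc m)} h = integral {0..r * real (Suc m)} h"
      using \<open>r > 0\<close> by (intro Henstock_Kurzweil_Integration.integral_combine h_int') auto
    ultimately show ?case using Suc by simp
  qed simp
  have "(\<Sum>j<m. real j * l (r * real (Suc j))) \<le> I / r\<^sup>2" for m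
  proof -
    have "integral {0..r * real m} h \<le> I"
      unfolding I_def using h_int h_int'
      by (intro integral_subset_le) (auto simp: h_def l0)
    then have "r\<^sup>2 * (\<Sum>j<m. real j * l (r * real (Suc j))) \<le> I"
      using step[of m] by (simp add: sum_distrib_left)
    then show ?thesis using \<open>r > 0\<close> by (simp add: pos_le_divide_eq mult.commute)
  qed
  note tail = this
  \<comment> \<open>As \<open>l \<le> 1\<close>, the terms \<open>k = 0, 1, 2\<close> contribute at
    most \<open>4 + 12 + 20 = 36\<close>. For \<open>k = m + 2\<close> with \<open>m \<ge> 1\<close>
    the size \<open>8 * m + 20\<close> is at most \<open>28 * m\<close>.\<close>
  define A where "A = 36 + 28 * (I / r\<^sup>2)"
  have I0: "0 \<le> I / r\<^sup>2" using tail[of 0] by simp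
  \<comment> \<open>The term \<open>k = 2\<close> enters when \<open>m\<close> becomes 1; its
    counterpart \<open>j = 0\<close> on the right vanishes, so it is paid for by the constant
    20.\<close>
  have bound: "(\<Sum>k<m + 2. (8 * real k + 4) * l (r * real (k - 1)))
      \<le> 16 + 20 * (if m = 0 then 0 else 1) + (\<Sum>j<m. 28 * (real j * l (r * real (Suc j))))" for m
  proof (induction m)
    case 0
    have "l 0 \<le> 1" using l_range by simp
    then show ?case by (simp add: numeral_2_eq_2)
  next
    case (Suc m)
    have pos: "0 \<le> l (r * real (Suc m))" "l (r * real (Suc m)) \<le> 1"
      using l_range[of "r * real (Suc m)"] \<open>r > 0\<close> by auto
    have "(8 * real (m + 2) + 4) * l (r * real (m + 2 - 1)) = (8 * real m + 20) * l (r * real (Suc m))"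
      by (simp add: algebra_simps)
    also have "\<dots> \<le> 20 * (if m = 0 then 1 else 0) + 28 * real m * l (r * real (Suc m))"
    proof (cases "m = 0")
      case False
      then have "8 * real m + 20 \<le> 28 * real m" by simp
      then show ?thesis using False pos by (simp add: mult_right_mono)
    qed (use pos in simp)
    finally show ?case using Suc by (auto simp: algebra_simps split: if_splits)
  qed
  have "(\<Sum>k<m. (8 * real k + 4) * l (r * real (k - 1))) \<le> A" for m
  proof -
    have "(\<Sum>k<m. (8 * real k + 4) * l (r * real (k - 1))) \<le> (\<Sum>k<m + 2. (8 * real k + 4) * l (r * real (k - 1)))"
      using \<open>r > 0\<close> by (intro sum_mono2) (auto simp: l0)
    also note bound[of m]
    also have "16 + 20 * (if m = 0 then 0 else 1) + (\<Sum>j<m. 28 * (real j * l (r * real (Suc j)))) \<le> A"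
      using tail[of m] I0 by (simp add: A_def sum_distrib_left[symmetric] split: if_splits)
    finally show ?thesis .
  qed
  moreover have "A > 0" using I0 by (simp add: A_def)
  ultimately show ?thesis using that by blast
qed

text \<open>An upper bound for \<open>l (norm (x - y))\<close> over \<open>x \<in> cell r z\<close> and \<open>y \<in> cell r w\<close>; the
  truncated subtraction yields \<open>l 0\<close> when the cells coincide or touch.\<close>

definition attenuation :: "(real \<Rightarrow> real) \<Rightarrow> real \<Rightarrow> int \<times> int \<Rightarrow> int \<times> int \<Rightarrow> real" where
  "attenuation l r z w = l (r * real (sup_dist z w - 1))"

text \<open>Finite windows exhausting the grid keep the interference a finite combination of counts,
  which is what the idcx order can handle.\<close>

definition window :: "nat \<Rightarrow> (int \<times> int) set" where
  "window n = {- int n..int n} \<times> {- int n..int n}"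

lemma finite_window [simp]: "finite (window n)"
  by (simp add: window_def)

lemma window_mono: "m \<le> n \<Longrightarrow> window m \<subseteq> window n"
  by (auto simp: window_def)

text \<open>A discretised interference, linear in the counts: it dominates what the points in the
  window can contribute at any location in the cell \<open>z\<close>.\<close>

definition cell_interference ::
  "(real \<Rightarrow> real) \<Rightarrow> real \<Rightarrow> nat \<Rightarrow> int \<times> int \<Rightarrow> (real^2) measure \<Rightarrow> real" where
  "cell_interference l r n z m = (\<Sum>w\<in>window n. attenuation l r z w * measure m (cell r w))"

text \<open>On each window \<open>f\<close> is below a step function whose integral is at most
  \<open>c\<close>; monotone convergence over the windows then removes the truncation.\<close>

lemma nn_integral_le_cellwise:
  assumes "r > 0" and m: "counting_measure m" and f: "f \<in> borel_measurable borel"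
    and a: "\<And>w. 0 \<le> a w" "\<And>w x. x \<in> cell r w \<Longrightarrow> f x \<le> ennreal (a w)"
    and c: "\<And>n. (\<Sum>w\<in>window n. a w * measure m (cell r w)) \<le> c"
  shows "(\<integral>\<^sup>+x. f x \<partial>m) \<le> ennreal c"
proof -
  have sets: "sets m = sets borel" using m by (simp add: counting_measure_def)
  note [measurable_cong] = sets
  note [measurable] = f
  define U where "U n = (\<Union>w\<in>window n. cell r w)" for n
  have [measurable]: "U n \<in> sets borel" for n by (simp add: U_def)
  have U_mono: "U i \<subseteq> U j" if "i \<le> j" for i j using window_mono[OF that] by (auto simp: U_def)
  have U_all: "\<exists>n. x \<in> U n" for x
  proof -
    define w where "w = (\<lfloor>x $ 1 / r\<rfloor>, \<lfloor>x $ 2 / r\<rfloor>)"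
    define n where "n = nat (max \<bar>fst w\<bar> \<bar>snd w\<bar>)"
    have "w \<in> window n" by (auto simp: window_def n_def mem_Times_iff)
    moreover have "x \<in> cell r w" by (simp add: cell_def w_def)
    ultimately show ?thesis by (auto simp: U_def)
  qed
  have f_sup: "f x = (SUP n. f x * indicator (U n) x)" for x
  proof (rule antisym)
    obtain n where "x \<in> U n" using U_all by blast
    then have "f x = f x * indicator (U n) x" by simp
    then show "f x \<le> (SUP n. f x * indicator (U n) x)" by (metis SUP_upper UNIV_I)
  qed (auto intro!: SUP_least simp: indicator_def)
  have bound: "(\<integral>\<^sup>+x. f x * indicator (U n) x \<partial>m) \<le> ennreal c" for n
  proof -
    have "f x * indicator (U n) x \<le> (\<Sum>w\<in>window n. ennreal (a w) * indicator (cell r w) x)" for x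
    proof (cases "x \<in> U n")
      case True
      then obtain w where w: "w \<in> window n" "x \<in> cell r w" by (auto simp: U_def)
      have "f x \<le> ennreal (a w) * indicator (cell r w) x" using a w by simp
      also have "\<dots> \<le> (\<Sum>w\<in>window n. ennreal (a w) * indicator (cell r w) x)"
        by (rule member_le_sum) (use w in auto)
      finally show ?thesis using True by simp
    qed simp
    then have "(\<integral>\<^sup>+x. f x * indicator (U n) x \<partial>m) \<le> (\<integral>\<^sup>+x. (\<Sum>w\<in>window n. ennreal (a w) * indicator (cell r w) x) \<partial>m)"
      by (intro nn_integral_mono) simp
    also have "\<dots> = (\<Sum>w\<in>window n. ennreal (a w) * emeasure m (cell r w))"
      by (subst nn_integral_sum) (auto intro!: sum.cong nn_integral_cmult_indicator simp: sets)
    also have "\<dots> = (\<Sum>w\<in>window n. ennreal (a w * measure m (cell r w)))"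
      using a by (intro sum.cong refl)
        (simp add: emeasure_counting_measure[OF m bounded_borel_cell[OF \<open>r > 0\<close>]] ennreal_mult)
    also have "\<dots> = ennreal (\<Sum>w\<in>window n. a w * measure m (cell r w))"
      using a by (intro sum_ennreal) simp
    also have "\<dots> \<le> ennreal c" by (rule ennreal_leI[OF c])
    finally show ?thesis .
  qed
  have "(\<integral>\<^sup>+x. f x \<partial>m) = (\<integral>\<^sup>+x. (SUP n. f x * indicator (U n) x) \<partial>m)"
    by (subst f_sup) (rule refl)
  also have "\<dots> = (SUP n. \<integral>\<^sup>+x. f x * indicator (U n) x \<partial>m)"
  proof (rule nn_integral_monotone_convergence_SUP)
    show "incseq (\<lambda>n x. f x * indicator (U n) x)"
      using U_mono by (auto simp: incseq_def le_fun_def indicator_def)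
  qed measurable
  also have "\<dots> \<le> ennreal c" by (rule SUP_least) (rule bound)
  finally show ?thesis .
qed

lemma interference_le:
  assumes "r > 0" and m: "counting_measure m"
    and l_range: "\<And>x. 0 \<le> x \<Longrightarrow> 0 < l x \<and> l x \<le> 1"
    and l_cont: "continuous_on {0..} l"
    and l_anti: "\<And>x y. 0 \<le> x \<Longrightarrow> x \<le> y \<Longrightarrow> l y \<le> l x"
    and x: "x \<in> cell r z" and c: "\<And>n. cell_interference l r n z m \<le> c"
  shows "interference l (remove_point m y) x \<le> ennreal c"
proof -
  have sets: "sets m = sets borel" using m by (simp add: counting_measure_def)
  note [measurable_cong] = sets
  define f where "f X = ennreal (l (norm (X - x)))" for X :: "real^2"
  have "continuous_on UNIV (\<lambda>X. l (norm (X - x)))"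
    by (rule continuous_on_compose2[OF l_cont]) (auto intro!: continuous_intros)
  then have f [measurable]: "f \<in> borel_measurable borel"
    unfolding f_def by (intro measurable_compose[OF _ measurable_ennreal] borel_measurable_continuous_onI)
  \<comment> \<open>Needed twice: \<open>interference\<close> excludes the receiving location, and
    the argument already lacks the point \<open>y\<close>. Either removal can only lower the
    integral.\<close>
  have rem: "(\<integral>\<^sup>+X. g X \<partial>(remove_point m' y)) \<le> (\<integral>\<^sup>+X. g X \<partial>m')"
    if "g \<in> borel_measurable borel" "sets m' = sets borel" for g and m' :: "(real^2) measure" and y
  proof -
    note [measurable_cong] = that(2)
    note [measurable] = that(1)
    have "(\<integral>\<^sup>+X. g X \<partial>(remove_point m' y)) = (\<integral>\<^sup>+X. indicator (- {y}) X * g X \<partial>m')"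
      unfolding remove_point_def by (rule nn_integral_density) measurable
    also have "\<dots> \<le> (\<integral>\<^sup>+X. g X \<partial>m')"
      by (intro nn_integral_mono) (simp add: indicator_def)
    finally show ?thesis .
  qed
  have "interference l (remove_point m y) x \<le> (\<integral>\<^sup>+X. f X \<partial>(remove_point m y))"
    unfolding interference_def f_def[symmetric] by (rule rem[OF f]) (simp add: remove_point_def sets)
  also have "\<dots> \<le> (\<integral>\<^sup>+X. f X \<partial>m)"
    by (rule rem[OF f sets])
  also have "\<dots> \<le> ennreal c"
  proof (rule nn_integral_le_cellwise[OF \<open>r > 0\<close> m f])
    show "0 \<le> attenuation l r z w" for w
      using l_range[of "r * real (sup_dist z w - 1)"] \<open>r > 0\<close> by (simp add: attenuation_def)
    show "f X \<le> ennreal (attenuation l r z w)" if "X \<in> cell r w" for w X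
      unfolding f_def attenuation_def
    proof (rule ennreal_leI, rule l_anti)
      show "r * real (sup_dist z w - 1) \<le> norm (X - x)"
        using cells_apart[OF \<open>r > 0\<close> x that] by (simp add: norm_minus_commute)
    qed (use \<open>r > 0\<close> in simp)
    show "(\<Sum>w\<in>window n. attenuation l r z w * measure m (cell r w)) \<le> c" for n
      using c by (simp add: cell_interference_def)
  qed
  finally show ?thesis .
qed

text \<open>The relation \<open>\<gamma> * P * c = N\<close> keeps the denominator at most
  \<open>2 * N\<close>, whence the factor 2 in the requirement on the signal.\<close>

lemma sinr_gt:
  assumes "N > 0" "T > 0" "P > 0" "\<gamma> > 0" "c > 0" "\<gamma> * P * c = N"
    and I: "interference l (remove_point m x) y \<le> ennreal c"
    and far: "2 * N * T < P * l (norm (x - y))"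
  shows "sinr l P N x y m \<gamma> > ennreal T"
proof -
  obtain i where i: "interference l (remove_point m x) y = ennreal i" "0 \<le> i" "i \<le> c"
    using I \<open>c > 0\<close> by (cases "interference l (remove_point m x) y") (auto simp: top_unique)
  have Pl: "0 \<le> P * l (norm (x - y))" using far assms(1,2) by (smt (verit) mult_pos_pos)
  have d: "0 < N + \<gamma> * P * i" using assms i by (simp add: add_pos_nonneg)
  have "\<gamma> * P * i \<le> N"
    using mult_left_mono[OF i(3), of "\<gamma> * P"] assms by simp
  then have "T * (N + \<gamma> * P * i) \<le> T * (2 * N)"
    using \<open>T > 0\<close> by (intro mult_left_mono) auto
  then have "T * (N + \<gamma> * P * i) < P * l (norm (x - y))" using far by (simp add: algebra_simps)
  then have "T < P * l (norm (x - y)) / (N + \<gamma> * P * i)"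
    using d by (simp add: pos_less_divide_eq)
  moreover have "sinr l P N x y m \<gamma> = ennreal (P * l (norm (x - y)) / (N + \<gamma> * P * i))"
    unfolding sinr_def i(1) using assms i Pl d
    by (simp add: ennreal_mult[symmetric] ennreal_plus[symmetric] divide_ennreal del: ennreal_plus)
  ultimately show ?thesis using \<open>T > 0\<close> by (simp add: ennreal_lessI)
qed

text \<open>Places the renormalised quadrant in the grid of cells. The cluster is built in the
  quadrant, while interference is received from the whole grid.\<close>

definition site :: "nat \<times> nat \<Rightarrow> int \<times> int" where
  "site u = (int (fst u), int (snd u))"

lemma inj_site: "inj site"
  by (auto simp: inj_def site_def prod_eq_iff)

text \<open>Points chosen in different cells are different, so \<open>f\<close> is injective on the
  cluster and maps it into a single component.\<close>

lemma percolates_if_infinite_cluster: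
  assumes inf: "infinite {v. (u, v) \<in> (site_edges G)\<^sup>*}" and "G u"
    and f: "\<And>v. G v \<Longrightarrow> f v \<in> V \<inter> cell r (site v)"
    and edge: "\<And>v w. (v, w) \<in> site_edges G \<Longrightarrow> (f v, f w) \<in> E"
  shows "percolates (V, E)"
proof -
  let ?C = "{v. (u, v) \<in> (site_edges G)\<^sup>*}"
  have C: "G v" "(f u, f v) \<in> E\<^sup>*" if "(u, v) \<in> (site_edges G)\<^sup>*" for v
    using that
  proof (induction rule: rtrancl_induct)
    case (step v w)
    show "G w" using step by (simp add: site_edges_def)
    show "(f u, f w) \<in> E\<^sup>*" using step edge by (meson rtrancl.rtrancl_into_rtrancl)
  qed (use \<open>G u\<close> in auto)
  have "inj_on f ?C"
  proof (rule inj_onI)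
    fix v w assume "v \<in> ?C" "w \<in> ?C" "f v = f w"
    then have "f v \<in> cell r (site v) \<inter> cell r (site w)" using f C by (metis Int_iff mem_Collect_eq)
    then have "site v = site w" using cell_disjoint by blast
    then show "v = w" using inj_site by (simp add: inj_eq)
  qed
  then have "infinite (f ` ?C)" using inf finite_imageD by blast
  moreover have "f ` ?C \<subseteq> connected_component_of_vertex (V, E) (f u)"
    using C f by (auto simp: connected_component_of_vertex_def)
  ultimately have "infinite (connected_component_of_vertex (V, E) (f u))" using finite_subset by blast
  moreover have "f u \<in> V" using f[OF \<open>G u\<close>] by simp
  ultimately show ?thesis by (auto simp: percolates_def)
qed

text \<open>With \<open>A\<close> the set where \<open>P\<close> holds, \<open>A\<close> or
  \<open>S - A\<close> contains at least half of \<open>S\<close>, and the event on the other set is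
  dropped. The squares \<open>d\<^sup>2\<close> compensate for the halved exponent, and the
  \<open>2 ^ card S\<close> choices of \<open>A\<close> give the factor 2.\<close>

lemma (in prob_space) prob_all_disj_le:
  assumes fin: "finite S" and "0 \<le> d" "d \<le> 1"
    and P: "\<And>z. Measurable.pred M (P z)" and Q: "\<And>z. Measurable.pred M (Q z)"
    and P_le: "\<And>A. A \<subseteq> S \<Longrightarrow> prob {\<omega> \<in> space M. \<forall>z\<in>A. P z \<omega>} \<le> (d\<^sup>2) ^ card A"
    and Q_le: "\<And>A. A \<subseteq> S \<Longrightarrow> prob {\<omega> \<in> space M. \<forall>z\<in>A. Q z \<omega>} \<le> (d\<^sup>2) ^ card A"
  shows "prob {\<omega> \<in> space M. \<forall>z\<in>S. P z \<omega> \<or> Q z \<omega>} \<le> (2 * d) ^ card S"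
proof -
  note [measurable] = P Q
  define F where "F A = {\<omega> \<in> space M. (\<forall>z\<in>A. P z \<omega>) \<and> (\<forall>z\<in>S - A. Q z \<omega>)}" for A
  have meas: "{\<omega> \<in> space M. \<forall>z\<in>A. R z \<omega>} \<in> events"
    if "A \<subseteq> S" "\<And>z. Measurable.pred M (R z)" for A R
    using that finite_subset[OF that(1) fin] by (intro predE pred_intros_finite)
  have F_eq: "F A = {\<omega> \<in> space M. \<forall>z\<in>A. P z \<omega>} \<inter> {\<omega> \<in> space M. \<forall>z\<in>S - A. Q z \<omega>}" for A
    by (auto simp: F_def)
  have F_meas: "F A \<in> events" if "A \<subseteq> S" for A
    unfolding F_eq using that by (intro sets.Int meas P Q) auto
  have F_le: "prob (F A) \<le> d ^ card S" if A: "A \<subseteq> S" for A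
  proof -
    have card: "card A + card (S - A) = card S"
      using A fin by (simp add: card_Diff_subset finite_subset card_mono)
    show ?thesis
    proof (cases "card S \<le> 2 * card A")
      case True
      have "prob (F A) \<le> prob {\<omega> \<in> space M. \<forall>z\<in>A. P z \<omega>}"
        using A by (intro finite_measure_mono meas P) (auto simp: F_def)
      also have "\<dots> \<le> d ^ (2 * card A)" using P_le[OF A] by (simp add: power_mult)
      also have "\<dots> \<le> d ^ card S" using True assms(2,3) by (intro power_decreasing)
      finally show ?thesis .
    next
      case False
      have "prob (F A) \<le> prob {\<omega> \<in> space M. \<forall>z\<in>S - A. Q z \<omega>}"
        using A by (intro finite_measure_mono meas Q) (auto simp: F_def)
      also have "\<dots> \<le> d ^ (2 * card (S - A))" using Q_le[of "S - A"] by (simp add: power_mult)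
      also have "\<dots> \<le> d ^ card S" using False card assms(2,3) by (intro power_decreasing) auto
      finally show ?thesis .
    qed
  qed
  have "{\<omega> \<in> space M. \<forall>z\<in>S. P z \<omega> \<or> Q z \<omega>} \<subseteq> (\<Union>A\<in>Pow S. F A)"
  proof
    fix \<omega> assume "\<omega> \<in> {\<omega> \<in> space M. \<forall>z\<in>S. P z \<omega> \<or> Q z \<omega>}"
    then have "\<omega> \<in> F {z \<in> S. P z \<omega>}" by (auto simp: F_def)
    then show "\<omega> \<in> (\<Union>A\<in>Pow S. F A)" by (rule UN_I[rotated]) simp
  qed
  then have "prob {\<omega> \<in> space M. \<forall>z\<in>S. P z \<omega> \<or> Q z \<omega>} \<le> prob (\<Union>A\<in>Pow S. F A)"
    using fin F_meas by (intro finite_measure_mono sets.finite_UN) auto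
  also have "\<dots> \<le> (\<Sum>A\<in>Pow S. prob (F A))"
    using fin F_meas by (intro finite_measure_subadditive_finite) auto
  also have "\<dots> \<le> (\<Sum>A\<in>Pow S. d ^ card S)"
    by (intro sum_mono F_le) auto
  also have "\<dots> = (2 * d) ^ card S"
    using fin by (simp add: card_Pow power_mult_distrib)
  finally show ?thesis .
qed

section \<open>Probability bounds for loud and for empty cells\<close>

lemma cell_interference_measurable:
  assumes "point_process M \<Phi>" "r > 0"
  shows "(\<lambda>\<omega>. cell_interference l r n z (\<Phi> \<omega>)) \<in> borel_measurable M"
  unfolding cell_interference_def
  by (intro borel_measurable_sum borel_measurable_times borel_measurable_const
      point_process_measure_measurable[OF assms(1)] bounded_borel_cell assms)

lemma cell_interference_mono:
  assumes "r > 0" "\<And>x. 0 \<le> x \<Longrightarrow> 0 \<le> l x" "m \<le> n"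
  shows "cell_interference l r m z \<phi> \<le> cell_interference l r n z \<phi>"
  unfolding cell_interference_def
  by (intro sum_mono2 window_mono assms) (use assms in \<open>auto simp: attenuation_def\<close>)

text \<open>If every cell of \<open>S\<close> exceeds level \<open>c\<close>, the sum of their
  interferences exceeds \<open>card S * c\<close>. This sum is one linear form in the counts, to
  which the Chernoff bound applies; the resulting exponent is proportional to
  \<open>card S\<close>.\<close>

lemma prob_high_interference_window_le:
  assumes pp: "point_process M \<Phi>" and pois: "poisson_process K \<Phi>\<^sub>K mu" and "mu \<ge> 0"
    and order: "idcx_le M \<Phi> K \<Phi>\<^sub>K"
    and mean: "\<And>B. bounded_borel B \<Longrightarrow> integrable M (\<lambda>\<omega>. measure (\<Phi> \<omega>) B)"
    and "r > 0" and l0: "\<And>x. 0 \<le> x \<Longrightarrow> 0 \<le> l x"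
    and "A > 0" and A: "\<And>m. (\<Sum>k<m. (8 * real k + 4) * l (r * real (k - 1))) \<le> A"
    and "finite S"
  shows "measure M {\<omega> \<in> space M. \<forall>z\<in>S. c < cell_interference l r n z (\<Phi> \<omega>)}
       \<le> exp (2 * mu * r\<^sup>2 - c / A) ^ card S"
proof -
  interpret prob_space M using pp by (simp add: point_process_def)
  define m where "m = card (window n)"
  \<comment> \<open>The Chernoff bound indexes its sets by an initial segment of the naturals, so
    the window is enumerated.\<close>
  obtain e where e: "bij_betw e {..<m} (window n)"
    using ex_bij_betw_nat_finite[OF finite_window[of n]] by (auto simp: m_def atLeast0LessThan)
  \<comment> \<open>Dividing by \<open>A\<close> brings the weights into the unit interval, however
    large \<open>S\<close> is.\<close>
  define a where "a w = (\<Sum>z\<in>S. attenuation l r z w) / A" for w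
  define \<kappa> where "\<kappa> = real (card S) * c / A"
  have att0: "0 \<le> attenuation l r z w" for z w
    using l0 \<open>r > 0\<close> by (simp add: attenuation_def)
  have col: "(\<Sum>w\<in>W. attenuation l r z w) \<le> A" if "finite W" for W z
    unfolding attenuation_def using that A l0 \<open>r > 0\<close>
    by (intro sum_over_shells_le[where g="\<lambda>k. l (r * real (k - 1))"]) auto
  \<comment> \<open>Summing over the receiving cells obeys the same bound as summing over the
    sources, since \<open>sup_dist\<close> is symmetric.\<close>
  have row: "(\<Sum>z\<in>S. attenuation l r z w) \<le> A" for w
    using col[OF \<open>finite S\<close>, of w] by (simp add: attenuation_def sup_dist_commute)
  have a: "0 \<le> a w" "a w \<le> 1" for w
    using row[of w] att0 \<open>A > 0\<close> by (auto simp: a_def sum_nonneg)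
  have reindex: "(\<Sum>i<m. g (e i)) = (\<Sum>w\<in>window n. g w)" for g :: "_ \<Rightarrow> real"
    using e by (rule sum.reindex_bij_betw)
  have sum_eq: "(\<Sum>i<m. a (e i) * measure \<phi> (cell r (e i))) = (\<Sum>z\<in>S. cell_interference l r n z \<phi>) / A" for \<phi>
  proof -
    have "(\<Sum>i<m. a (e i) * measure \<phi> (cell r (e i))) = (\<Sum>w\<in>window n. a w * measure \<phi> (cell r w))"
      by (rule reindex)
    also have "\<dots> = (\<Sum>w\<in>window n. \<Sum>z\<in>S. attenuation l r z w * measure \<phi> (cell r w) / A)"
      by (simp add: a_def sum_distrib_right sum_divide_distrib)
    also have "\<dots> = (\<Sum>z\<in>S. \<Sum>w\<in>window n. attenuation l r z w * measure \<phi> (cell r w) / A)"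
      by (rule sum.swap)
    finally show ?thesis by (simp add: cell_interference_def sum_divide_distrib)
  qed
  have inj: "inj_on e {..<m}" using e by (rule bij_betw_imp_inj_on)
  have meas: "{\<omega> \<in> space M. \<kappa> \<le> (\<Sum>i<m. a (e i) * measure (\<Phi> \<omega>) (cell r (e i)))} \<in> events"
    unfolding sum_eq using cell_interference_measurable[OF pp \<open>r > 0\<close>]
    by (intro borel_measurable_le borel_measurable_const borel_measurable_divide borel_measurable_sum) auto
  have "prob {\<omega> \<in> space M. \<forall>z\<in>S. c < cell_interference l r n z (\<Phi> \<omega>)}
      \<le> prob {\<omega> \<in> space M. \<kappa> \<le> (\<Sum>i<m. a (e i) * measure (\<Phi> \<omega>) (cell r (e i)))}"
  proof (rule finite_measure_mono[OF _ meas])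
    show "{\<omega> \<in> space M. \<forall>z\<in>S. c < cell_interference l r n z (\<Phi> \<omega>)}
        \<subseteq> {\<omega> \<in> space M. \<kappa> \<le> (\<Sum>i<m. a (e i) * measure (\<Phi> \<omega>) (cell r (e i)))}"
    proof safe
      fix \<omega> assume *: "\<forall>z\<in>S. c < cell_interference l r n z (\<Phi> \<omega>)"
      have "real (card S) * c = (\<Sum>z\<in>S. c)" by simp
      also have "\<dots> \<le> (\<Sum>z\<in>S. cell_interference l r n z (\<Phi> \<omega>))"
        using * by (intro sum_mono) auto
      finally show "\<kappa> \<le> (\<Sum>i<m. a (e i) * measure (\<Phi> \<omega>) (cell r (e i)))"
        unfolding sum_eq \<kappa>_def using \<open>A > 0\<close> by (intro divide_right_mono) auto
    qed
  qed
  also have "\<dots> \<le> exp ((\<Sum>i<m. mu * measure lborel (cell r (e i)) * (exp (a (e i)) - 1)) - \<kappa>)"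
  proof (rule idcx_chernoff[OF pp pois \<open>mu \<ge> 0\<close> order mean])
    show "disjoint_family_on (\<lambda>i. cell r (e i)) {..<m}"
      unfolding disjoint_family_on_def
      using inj by (intro ballI impI cell_disjoint) (auto dest: inj_onD)
  qed (use a bounded_borel_cell[OF \<open>r > 0\<close>] in auto)
  also have "\<dots> \<le> exp (real (card S) * (2 * mu * r\<^sup>2 - c / A))"
  proof -
    have "(\<Sum>i<m. mu * measure lborel (cell r (e i)) * (exp (a (e i)) - 1)) = (\<Sum>w\<in>window n. mu * r\<^sup>2 * (exp (a w) - 1))"
      unfolding measure_cell[OF \<open>r > 0\<close>] by (rule reindex[of "\<lambda>w. mu * r\<^sup>2 * (exp (a w) - 1)"])
    also have "\<dots> \<le> (\<Sum>w\<in>window n. mu * r\<^sup>2 * (2 * a w))"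
    proof (intro sum_mono mult_left_mono)
      fix w
      have "exp (a w) \<le> 1 + a w + (a w)\<^sup>2" using a by (intro exp_bound) auto
      moreover have "(a w)\<^sup>2 \<le> a w" using a[of w] by (simp add: power2_eq_square mult_left_le)
      ultimately show "exp (a w) - 1 \<le> 2 * a w" by simp
    qed (use \<open>mu \<ge> 0\<close> in auto)
    \<comment> \<open>After exchanging the sums, each cell of \<open>S\<close> contributes at most
      \<open>A / A = 1\<close>, uniformly in the window.\<close>
    also have "\<dots> = 2 * mu * r\<^sup>2 * ((\<Sum>z\<in>S. \<Sum>w\<in>window n. attenuation l r z w) / A)"
      by (subst sum.swap) (simp add: a_def sum_distrib_left sum_divide_distrib algebra_simps)
    also have "\<dots> \<le> 2 * mu * r\<^sup>2 * (\<Sum>z\<in>S. 1)"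
    proof (intro mult_left_mono)
      have "(\<Sum>z\<in>S. \<Sum>w\<in>window n. attenuation l r z w) \<le> (\<Sum>z\<in>S. A)"
        by (intro sum_mono col) simp
      then show "(\<Sum>z\<in>S. \<Sum>w\<in>window n. attenuation l r z w) / A \<le> (\<Sum>z\<in>S. 1)"
        using \<open>A > 0\<close> by (simp add: pos_divide_le_eq)
    qed (use \<open>mu \<ge> 0\<close> in auto)
    finally show ?thesis by (simp add: \<kappa>_def algebra_simps)
  qed
  also have "\<dots> = exp (2 * mu * r\<^sup>2 - c / A) ^ card S"
    by (rule exp_of_nat_mult)
  finally show ?thesis .
qed

text \<open>The events increase with the window and their bound is independent of it, so continuity
  from below passes to the whole grid.\<close>

lemma prob_high_interference_le:
  assumes pp: "point_process M \<Phi>" and pois: "poisson_process K \<Phi>\<^sub>K mu" and "mu \<ge> 0"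
    and order: "idcx_le M \<Phi> K \<Phi>\<^sub>K"
    and mean: "\<And>B. bounded_borel B \<Longrightarrow> integrable M (\<lambda>\<omega>. measure (\<Phi> \<omega>) B)"
    and "r > 0" and l0: "\<And>x. 0 \<le> x \<Longrightarrow> 0 \<le> l x"
    and "A > 0" and A: "\<And>m. (\<Sum>k<m. (8 * real k + 4) * l (r * real (k - 1))) \<le> A"
    and "finite S"
  shows "measure M {\<omega> \<in> space M. \<forall>z\<in>S. \<exists>n. c < cell_interference l r n z (\<Phi> \<omega>)}
       \<le> exp (2 * mu * r\<^sup>2 - c / A) ^ card S"
proof -
  interpret prob_space M using pp by (simp add: point_process_def)
  define D where "D n = {\<omega> \<in> space M. \<forall>z\<in>S. c < cell_interference l r n z (\<Phi> \<omega>)}" for n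
  note [measurable] = cell_interference_measurable[OF pp \<open>r > 0\<close>]
  have mono: "c < cell_interference l r n z \<phi>" if "c < cell_interference l r m z \<phi>" "m \<le> n" for m n z \<phi>
    using cell_interference_mono[OF \<open>r > 0\<close> l0 that(2)] that(1) by (meson less_le_trans)
  have D_meas: "D n \<in> events" for n
    unfolding D_def using \<open>finite S\<close> by (intro predE pred_intros_finite) measurable
  have "incseq D" unfolding incseq_def D_def using mono by blast
  have D_Union: "(\<Union>n. D n) = {\<omega> \<in> space M. \<forall>z\<in>S. \<exists>n. c < cell_interference l r n z (\<Phi> \<omega>)}"
  proof (intro subset_antisym subsetI)
    fix \<omega> assume "\<omega> \<in> {\<omega> \<in> space M. \<forall>z\<in>S. \<exists>n. c < cell_interference l r n z (\<Phi> \<omega>)}"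
    then obtain k where k: "\<omega> \<in> space M" "\<And>z. z \<in> S \<Longrightarrow> c < cell_interference l r (k z) z (\<Phi> \<omega>)" by auto metis
    \<comment> \<open>As \<open>S\<close> is finite, one window serves all its cells, so the
      quantifiers over \<open>z\<close> and \<open>n\<close> may be exchanged.\<close>
    obtain n where "\<And>z. z \<in> S \<Longrightarrow> k z \<le> n"
      using finite_nat_set_iff_bounded_le[of "k ` S"] \<open>finite S\<close> by auto
    with k have "\<omega> \<in> D n" unfolding D_def using mono by blast
    then show "\<omega> \<in> (\<Union>n. D n)" by blast
  qed (auto simp: D_def)
  have "(\<lambda>n. prob (D n)) \<longlonglongrightarrow> prob (\<Union>n. D n)"
    using D_meas \<open>incseq D\<close> by (intro finite_Lim_measure_incseq) auto
  moreover have "prob (D n) \<le> exp (2 * mu * r\<^sup>2 - c / A) ^ card S" for n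
    unfolding D_def by (rule prob_high_interference_window_le) (fact assms)+
  ultimately have "prob (\<Union>n. D n) \<le> exp (2 * mu * r\<^sup>2 - c / A) ^ card S"
    by (intro LIMSEQ_le_const2) auto
  then show ?thesis unfolding D_Union .
qed

text \<open>The cells of \<open>S\<close> are all empty only if their union is, and the area of the
  union puts \<open>card S\<close> into the exponent.\<close>

lemma prob_void_cells_le:
  assumes pp: "point_process M \<Phi>" and pois: "poisson_process L \<Phi>\<^sub>L lam"
    and order: "ddcx_le M \<Phi> L \<Phi>\<^sub>L" and "r > 0" "finite S"
  shows "measure M {\<omega> \<in> space M. \<forall>z\<in>S. measure (\<Phi> \<omega>) (cell r z) = 0} \<le> exp (- (lam * r\<^sup>2)) ^ card S"
proof -
  interpret prob_space M using pp by (simp add: point_process_def)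
  let ?U = "\<Union>z\<in>S. cell r z"
  note U = measure_Union_cells[OF \<open>r > 0\<close> \<open>finite S\<close>]
  note [measurable] = point_process_measure_measurable[OF pp U(1)]
  have "measure (\<Phi> \<omega>) ?U = 0"
    if \<omega>: "\<omega> \<in> space M" and void: "\<forall>z\<in>S. measure (\<Phi> \<omega>) (cell r z) = 0" for \<omega>
  proof -
    have m: "counting_measure (\<Phi> \<omega>)" using pp \<omega> by (simp add: point_process_def)
    then have "cell r z \<in> null_sets (\<Phi> \<omega>)" if "z \<in> S" for z
      using void that emeasure_counting_measure[OF m bounded_borel_cell[OF \<open>r > 0\<close>]]
      by (auto simp: null_sets_def counting_measure_def)
    then have "?U \<in> null_sets (\<Phi> \<omega>)" using \<open>finite S\<close> by (intro null_sets.finite_UN) auto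
    then show ?thesis by (auto simp: null_sets_def measure_def)
  qed
  then have "prob {\<omega> \<in> space M. \<forall>z\<in>S. measure (\<Phi> \<omega>) (cell r z) = 0} \<le> prob {\<omega> \<in> space M. measure (\<Phi> \<omega>) ?U = 0}"
    by (intro finite_measure_mono) auto
  also have "\<dots> \<le> exp (- (lam * measure lborel ?U))"
    by (rule void_probability_le[OF pp pois order U(1)])
  also have "\<dots> = exp (real (card S) * - (lam * r\<^sup>2))"
    by (simp add: U(2) algebra_simps)
  also have "\<dots> = exp (- (lam * r\<^sup>2)) ^ card S" by (rule exp_of_nat_mult)
  finally show ?thesis .
qed

section \<open>Percolation of the SINR graph\<close>

theorem mainTheorem3:
  fixes N T :: real
    and l :: "real \<Rightarrow> real"
    and M :: "'w measure" and \<Phi>\<^sub>B \<Phi>\<^sub>I :: "'w \<Rightarrow> (real^2) measure"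
    and L :: "'u measure" and \<Phi>\<^sub>L :: "'u \<Rightarrow> (real^2) measure" and lam :: real
    and K :: "'v measure" and \<Phi>\<^sub>K :: "'v \<Rightarrow> (real^2) measure" and mu :: real
  assumes "N > 0" and "T > 0"
    and l_range: "\<And>x. 0 \<le> x \<Longrightarrow> 0 < l x \<and> l x \<le> 1"
    and l_cont: "continuous_on {0..} l"
    and l_decr: "strict_antimono_on {0..} l"
    and l_int: "set_integrable lborel {0..} (\<lambda>x. x * l x)"
    and pp_B: "point_process M \<Phi>\<^sub>B"
    and pp_I: "point_process M \<Phi>\<^sub>I"
    and mean_I: "\<And>B. bounded_borel B \<Longrightarrow> integrable M (\<lambda>\<omega>. measure (\<Phi>\<^sub>I \<omega>) B)"
    and "lam > 0" and "poisson_process L \<Phi>\<^sub>L lam" and "ddcx_le M \<Phi>\<^sub>B L \<Phi>\<^sub>L"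
    and "mu > 0" and "poisson_process K \<Phi>\<^sub>K mu" and "idcx_le M \<Phi>\<^sub>I K \<Phi>\<^sub>K"
  shows "\<exists>P>0. l 0 \<ge> T * N / P \<and>
           (\<exists>\<gamma>>0. AE \<omega> in M. percolates (sinr_graph l P N T (\<Phi>\<^sub>B \<omega>) (\<Phi>\<^sub>I \<omega>) \<gamma>))"
proof -
  interpret prob_space M using pp_B by (simp add: point_process_def)
  have anti: "l y \<le> l x" if "0 \<le> x" "x \<le> y" for x y
    using l_decr that by (cases "x = y") (auto simp: monotone_on_def intro: less_imp_le)
  have l0: "0 \<le> l x" if "0 \<le> x" for x using l_range[OF that] by simp

  \<comment> \<open>\<open>2 * d = 1 / 162\<close> is the largest density that the renormalisation
    admits; empty and loud cells are each allowed \<open>d\<^sup>2\<close>.\<close>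
  define d :: real where "d = 1 / 324"
  define q where "q = ln (1 / d\<^sup>2)"
  have q: "0 < q" "exp (- q) = d\<^sup>2" by (auto simp: q_def d_def exp_minus power2_eq_square)
  \<comment> \<open>Makes \<open>lam * r\<^sup>2 = q\<close>, so that the void bound for a cell is
    \<open>exp (- q) = d\<^sup>2\<close>.\<close>
  define r where "r = sqrt (q / lam)"
  have r: "r > 0" "lam * r\<^sup>2 = q" using q \<open>lam > 0\<close> by (auto simp: r_def)
  obtain A where A: "A > 0" "\<And>m. (\<Sum>k<m. (8 * real k + 4) * l (r * real (k - 1))) \<le> A"
    using shell_sums_bounded[OF r(1) l_range l_cont l_decr l_int] by blast
  \<comment> \<open>Solves \<open>2 * mu * r\<^sup>2 - c / A = - q\<close>, so that the bound for
    loud cells is \<open>d\<^sup>2\<close> as well.\<close>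
  define c where "c = A * (2 * mu * r\<^sup>2 + q)"
  have c: "c > 0" "2 * mu * r\<^sup>2 - c / A = - q"
    using A(1) q(1) \<open>mu > 0\<close> by (auto simp: c_def add_nonneg_pos)
  \<comment> \<open>Points in adjacent cells are at distance at most \<open>4 * r\<close>, so the
    signal is at least \<open>3 * T * N\<close>, strictly above the \<open>2 * N * T\<close> needed
    against doubled noise.\<close>
  define P where "P = 3 * T * N / l (4 * r)"
  have l4r: "l (4 * r) > 0" using l_range[of "4 * r"] r(1) by simp
  have P: "P > 0" "P * l (4 * r) = 3 * T * N"
    using \<open>N > 0\<close> \<open>T > 0\<close> l4r by (auto simp: P_def)
  \<comment> \<open>At interference level \<open>c\<close> the reduced interference
    \<open>\<gamma> * P * c\<close> equals the noise \<open>N\<close>.\<close>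
  define \<gamma> where "\<gamma> = N / (P * c)"
  have \<gamma>: "\<gamma> > 0" "\<gamma> * P * c = N" using \<open>N > 0\<close> P(1) c(1) by (auto simp: \<gamma>_def)

  define void where "void z \<omega> \<longleftrightarrow> measure (\<Phi>\<^sub>B \<omega>) (cell r (site z)) = 0" for z \<omega>
  define loud where "loud z \<omega> \<longleftrightarrow> (\<exists>n. c < cell_interference l r n (site z) (\<Phi>\<^sub>I \<omega>))" for z \<omega>
  define b where "b \<omega> z \<longleftrightarrow> void z \<omega> \<or> loud z \<omega>" for \<omega> z
  note [measurable] = point_process_measure_measurable[OF pp_B bounded_borel_cell[OF r(1)]]
    cell_interference_measurable[OF pp_I r(1)]
  have [measurable]: "Measurable.pred M (void z)" "Measurable.pred M (loud z)" for z
    unfolding void_def loud_def by measurable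
  have card_site: "card (site ` S) = card S" for S
    by (rule card_image) (rule inj_on_subset[OF inj_site subset_UNIV])
  have void_le: "prob {\<omega> \<in> space M. \<forall>z\<in>S. void z \<omega>} \<le> (d\<^sup>2) ^ card S" if "finite S" for S
    using prob_void_cells_le[OF pp_B \<open>poisson_process L \<Phi>\<^sub>L lam\<close> \<open>ddcx_le M \<Phi>\<^sub>B L \<Phi>\<^sub>L\<close> r(1), of "site ` S"]
      that by (simp add: void_def card_site r(2) q(2))
  have loud_le: "prob {\<omega> \<in> space M. \<forall>z\<in>S. loud z \<omega>} \<le> (d\<^sup>2) ^ card S" if "finite S" for S
    using prob_high_interference_le[OF pp_I \<open>poisson_process K \<Phi>\<^sub>K mu\<close> _ \<open>idcx_le M \<Phi>\<^sub>I K \<Phi>\<^sub>K\<close> mean_I r(1) l0 A,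
        of "site ` S" c] that \<open>mu > 0\<close> by (simp add: loud_def card_site c(2) q(2))
  have "AE \<omega> in M. \<exists>u. \<not> b \<omega> u \<and> infinite {v. (u, v) \<in> (site_edges (\<lambda>z. \<not> b \<omega> z))\<^sup>*}"
  proof (rule AE_infinite_good_cluster)
    show "prob {\<omega> \<in> space M. \<forall>z\<in>S. b \<omega> z} \<le> (2 * d) ^ card S" if "finite S" for S
      unfolding b_def
      by (rule prob_all_disj_le)
         (use that in \<open>auto simp: d_def[symmetric] intro!: void_le loud_le intro: finite_subset\<close>, auto simp: d_def)
  qed (auto simp: d_def b_def)
  then have "AE \<omega> in M. percolates (sinr_graph l P N T (\<Phi>\<^sub>B \<omega>) (\<Phi>\<^sub>I \<omega>) \<gamma>)"
  proof (rule AE_mp, intro AE_I2 impI)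
    fix \<omega> assume \<omega>: "\<omega> \<in> space M"
      and "\<exists>u. \<not> b \<omega> u \<and> infinite {v. (u, v) \<in> (site_edges (\<lambda>z. \<not> b \<omega> z))\<^sup>*}"
    then obtain u where u: "\<not> b \<omega> u" "infinite {v. (u, v) \<in> (site_edges (\<lambda>z. \<not> b \<omega> z))\<^sup>*}"
      by blast
    have mB: "counting_measure (\<Phi>\<^sub>B \<omega>)" and mI: "counting_measure (\<Phi>\<^sub>I \<omega>)"
      using pp_B pp_I \<omega> by (auto simp: point_process_def)
    have "\<exists>x. x \<in> points (\<Phi>\<^sub>B \<omega>) \<inter> cell r (site v)" if "\<not> b \<omega> v" for v
    proof -
      have "measure (\<Phi>\<^sub>B \<omega>) (cell r (site v)) > 0"
        using that measure_nonneg[of "\<Phi>\<^sub>B \<omega>" "cell r (site v)"] unfolding b_def void_def by linarith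
      then show ?thesis using exists_atom[OF mB bounded_borel_cell[OF r(1)]] by blast
    qed
    then obtain f where f: "\<And>v. \<not> b \<omega> v \<Longrightarrow> f v \<in> points (\<Phi>\<^sub>B \<omega>) \<inter> cell r (site v)" by metis
    \<comment> \<open>A good cell has all its windowed interferences at most \<open>c\<close>; this
      bounds the true interference everywhere in the cell, whichever point \<open>y\<close> is
      removed.\<close>
    have quiet: "interference l (remove_point (\<Phi>\<^sub>I \<omega>) y) x \<le> ennreal c"
      if "\<not> b \<omega> v" "x \<in> cell r (site v)" for v x y
      using that by (intro interference_le[OF r(1) mI l_range l_cont anti]) (auto simp: b_def loud_def not_less)
    show "percolates (sinr_graph l P N T (\<Phi>\<^sub>B \<omega>) (\<Phi>\<^sub>I \<omega>) \<gamma>)"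
      unfolding sinr_graph_def
    proof (rule percolates_if_infinite_cluster[OF u(2) u(1) f])
      fix v w assume vw: "(v, w) \<in> site_edges (\<lambda>z. \<not> b \<omega> z)"
      then have good: "\<not> b \<omega> v" "\<not> b \<omega> w" and "site v \<noteq> site w"
        and near: "\<bar>fst (site v) - fst (site w)\<bar> \<le> 1" "\<bar>snd (site v) - snd (site w)\<bar> \<le> 1"
        by (auto simp: site_edges_def site_def)
      have cells: "f v \<in> cell r (site v)" "f w \<in> cell r (site w)"
        and pts: "f v \<in> points (\<Phi>\<^sub>B \<omega>)" "f w \<in> points (\<Phi>\<^sub>B \<omega>)" using f good by auto
      have "f v \<noteq> f w" using cells cell_disjoint[OF \<open>site v \<noteq> site w\<close>] by (metis IntI empty_iff)
      have "norm (f v - f w) \<le> 4 * r" by (rule cells_near[OF r(1) cells near])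
      then have "P * l (4 * r) \<le> P * l (norm (f v - f w))"
        using P(1) by (intro mult_left_mono anti) auto
      moreover have "2 * N * T < 3 * T * N" using \<open>N > 0\<close> \<open>T > 0\<close> by simp
      ultimately have far: "2 * N * T < P * l (norm (f v - f w))" using P(2) by linarith
      have "sinr l P N (f w) (f v) (\<Phi>\<^sub>I \<omega>) \<gamma> > ennreal T"
        using far by (intro sinr_gt[OF \<open>N > 0\<close> \<open>T > 0\<close> P(1) \<gamma>(1) c(1) \<gamma>(2) quiet[OF good(1) cells(1)]])
          (simp add: norm_minus_commute)
      moreover have "sinr l P N (f v) (f w) (\<Phi>\<^sub>I \<omega>) \<gamma> > ennreal T"
        using far by (intro sinr_gt[OF \<open>N > 0\<close> \<open>T > 0\<close> P(1) \<gamma>(1) c(1) \<gamma>(2) quiet[OF good(2) cells(2)]])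
      ultimately show "(f v, f w) \<in> {(X, Y). X \<in> points (\<Phi>\<^sub>B \<omega>) \<and> Y \<in> points (\<Phi>\<^sub>B \<omega>) \<and> X \<noteq> Y \<and>
         sinr l P N Y X (\<Phi>\<^sub>I \<omega>) \<gamma> > ennreal T \<and> sinr l P N X Y (\<Phi>\<^sub>I \<omega>) \<gamma> > ennreal T}"
        using pts \<open>f v \<noteq> f w\<close> by simp
    qed
  qed
  moreover have "l 0 \<ge> T * N / P"
  proof -
    have "T * N / P = l (4 * r) / 3" using \<open>N > 0\<close> \<open>T > 0\<close> by (simp add: P_def)
    also have "\<dots> \<le> l 0" using anti[of 0 "4 * r"] r(1) l4r by simp
    finally show ?thesis .
  qed
  ultimately show ?thesis using P(1) \<gamma>(1) by blast
qed

end
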